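(* Let $\mathcal H$ be a complex separable Hilbert space with a fixed orthogonal decomposition $\mathcal H=\bigoplus_{j=0}^\infty H_j$, $H_j=\operatorname{span}\{e_j^k\}_{k=1}^{d_j}$, where $\{e_j^k\}_{j\in\mathbb N_0,\,1\le k\le d_j}$ is an orthonormal basis of $\mathcal H$ and $d_j\in\mathbb N$. If $T\in S_1(\mathcal H)$ is a Fourier multiplier relative to $\{H_j\}_{j\in\mathbb N_0}$, with matrix symbol $\sigma_T$, then $$\operatorname{Det}(I+\lambda T)=\exp\left(\sum_{m=1}^\infty\frac{(-1)^{m+1}}{m}\lambda^m\sum_{\ell=0}^\infty\operatorname{Tr}\big(\sigma_T(\ell)^m\big)\right)$$ for $\lambda\in\mathbb C$ with $|\lambda|$ small enough.
   Context: $S_1(\mathcal H)$ is the trace class on $\mathcal H$, with norm $\|T\|_{S_1}=\sum_k s_k(T)$ (sum of singular values). For $T\in S_1(\mathcal H)$, $\operatorname{Det}(I+T)$ is the (Fredholm) determinant, i.e. the extension, continuous in the $S_1$-norm, of $\operatorname{Det}(I+F)=\prod_j(1+\lambda_j(F))$ from finite rank operators $F$ (nonzero eigenvalues $\lambda_j(F)$ counted with algebraic multiplicity). A Fourier multiplier (or invariant operator) relative to $\{H_j\}$ is a linear operator $T$ with $T(H_j)\subset H_j$ for every $j\in\mathbb N_0$. Equivalently, writing $\widehat f(j,k)=(f,e_j^k)_{\mathcal H}$ and $\widehat f(j)\in\mathbb C^{d_j}$ for the column vector with entries $\widehat f(j,k)$, $1\le k\le d_j$, there are matrices $\sigma_T(\ell)\in\mathbb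 C^{d_\ell\times d_\ell}$ with $\widehat{Te_j^k}(\ell,m)=\sigma_T(\ell)_{mk}\delta_{j\ell}$, equivalently $\widehat{Tf}(\ell)=\sigma_T(\ell)\widehat f(\ell)$. The family $\sigma_T=(\sigma_T(\ell))_{\ell\in\mathbb N_0}$ is the matrix symbol of $T$ relative to the decomposition and basis. $\operatorname{Tr}(\sigma_T(\ell)^m)$ is the usual matrix trace. *)

theory Defs
  imports "HOL-Analysis.Analysis" "Jordan_Normal_Form.Matrix"
begin

section \<open>Complex Hilbert spaces\<close>

text \<open>The inner product is linear in its first argument.  Positive definiteness is contained in
  the last axiom, because norms are nonnegative and vanish only at 0.\<close>

class complex_inner = real_normed_vector +
  fixes scaleC :: "complex \<Rightarrow> 'a \<Rightarrow> 'a"  (infixr \<open>*\<^sub>C\<close> 75)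
    and cinner :: "'a \<Rightarrow> 'a \<Rightarrow> complex"
  assumes scaleC_add_right: "a *\<^sub>C (x + y) = a *\<^sub>C x + a *\<^sub>C y"
    and scaleC_add_left: "(a + b) *\<^sub>C x = a *\<^sub>C x + b *\<^sub>C x"
    and scaleC_scaleC: "a *\<^sub>C (b *\<^sub>C x) = (a * b) *\<^sub>C x"
    and scaleR_scaleC: "r *\<^sub>R x = complex_of_real r *\<^sub>C x"
    and cinner_commute: "cinner x y = cnj (cinner y x)"
    and cinner_add_left: "cinner (x + y) z = cinner x z + cinner y z"
    and cinner_scaleC_left: "cinner (a *\<^sub>C x) y = a * cinner x y"
    and cinner_self: "cinner x x = complex_of_real ((norm x)\<^sup>2)"

class complex_hilbert = complex_inner + complete_space

instantiation complex :: complex_hilbert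
begin
definition scaleC_complex :: "complex \<Rightarrow> complex \<Rightarrow> complex" where
  "scaleC_complex a x = a * x"
definition cinner_complex :: "complex \<Rightarrow> complex \<Rightarrow> complex" where
  "cinner_complex x y = x * cnj y"
instance
  by standard
    (simp_all add: scaleC_complex_def cinner_complex_def algebra_simps scaleR_conv_of_real
      complex_norm_square[symmetric])
end

lemma scaleC_one: "1 *\<^sub>C x = (x :: 'h::complex_inner)"
  using scaleR_scaleC[of 1 x] by simp

global_interpretation complex_vector:
  vector_space "scaleC :: complex \<Rightarrow> 'h \<Rightarrow> 'h::complex_inner"
  defines cspan = complex_vector.span
    and cdim = complex_vector.dim
  by standard (simp_all add: scaleC_add_right scaleC_add_left scaleC_scaleC scaleC_one)

definition orthonormal_basis :: "('i \<Rightarrow> 'h::complex_hilbert) \<Rightarrow> 'i set \<Rightarrow> bool" where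
  "orthonormal_basis b I \<longleftrightarrow>
     (\<forall>i\<in>I. \<forall>i'\<in>I. cinner (b i) (b i') = (if i = i' then 1 else 0)) \<and>
     closure (cspan (b ` I)) = UNIV"


section \<open>Trace class operators\<close>

definition bounded_clinear :: "('h::complex_hilbert \<Rightarrow> 'h) \<Rightarrow> bool" where
  "bounded_clinear T \<longleftrightarrow> bounded_linear T \<and> (\<forall>c x. T (c *\<^sub>C x) = c *\<^sub>C T x)"

definition compact_operator :: "('h::complex_hilbert \<Rightarrow> 'h) \<Rightarrow> bool" where
  "compact_operator T \<longleftrightarrow> bounded_clinear T \<and> compact (closure (T ` cball 0 1))"

definition finite_rank :: "('h::complex_hilbert \<Rightarrow> 'h) \<Rightarrow> bool" where
  "finite_rank F \<longleftrightarrow> bounded_clinear F \<and> (\<exists>B. finite B \<and> range F \<subseteq> cspan B)"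

definition cadjoint :: "('h::complex_hilbert \<Rightarrow> 'h) \<Rightarrow> 'h \<Rightarrow> 'h" where
  "cadjoint T = (THE S. \<forall>x y. cinner (T x) y = cinner x (S y))"

text \<open>The decreasing enumeration \<open>s\<close> of the singular values of \<open>T\<close>, i.e. of the square roots of
  the eigenvalues of \<open>T\<^sup>*T\<close>: every positive number occurs in \<open>s\<close> as often as
  its square is an eigenvalue of \<open>T\<^sup>*T\<close>, and \<open>s\<close> is padded with zeros if there are only finitely
  many positive singular values.  Since \<open>cdim\<close> of an infinite-dimensional space is 0, this is
  meaningful only when the eigenspaces involved are finite-dimensional; it is used only for
  compact \<open>T\<close>.\<close>

definition singular_value_seq :: "('h::complex_hilbert \<Rightarrow> 'h) \<Rightarrow> (nat \<Rightarrow> real) \<Rightarrow> bool" where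
  "singular_value_seq T s \<longleftrightarrow>
     decseq s \<and> (\<forall>k. 0 \<le> s k) \<and>
     (\<forall>r>0. finite {k. s k = r} \<and>
        card {k. s k = r} = cdim {x. cadjoint T (T x) = complex_of_real (r\<^sup>2) *\<^sub>C x})"

definition singular_values :: "('h::complex_hilbert \<Rightarrow> 'h) \<Rightarrow> nat \<Rightarrow> real" where
  "singular_values T = (THE s. singular_value_seq T s)"

definition trace_class :: "('h::complex_hilbert \<Rightarrow> 'h) \<Rightarrow> bool" where
  "trace_class T \<longleftrightarrow> compact_operator T \<and> (\<exists>s. singular_value_seq T s \<and> summable s)"

definition trace_norm :: "('h::complex_hilbert \<Rightarrow> 'h) \<Rightarrow> real" where
  "trace_norm T = (\<Sum>k. singular_values T k)"


section \<open>The Fredholm determinant\<close>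

definition eigenvalues :: "('h::complex_hilbert \<Rightarrow> 'h) \<Rightarrow> complex set" where
  "eigenvalues F = {\<mu>. \<exists>x. x \<noteq> 0 \<and> F x = \<mu> *\<^sub>C x}"

definition alg_multiplicity :: "('h::complex_hilbert \<Rightarrow> 'h) \<Rightarrow> complex \<Rightarrow> nat" where
  "alg_multiplicity F \<mu> = cdim {x. \<exists>n. ((\<lambda>y. F y - \<mu> *\<^sub>C y) ^^ n) x = 0}"

text \<open>\<open>Det_finite_rank F\<close> is \<open>Det (I + F)\<close> for \<open>F\<close> of finite rank.\<close>

definition Det_finite_rank :: "('h::complex_hilbert \<Rightarrow> 'h) \<Rightarrow> complex" where
  "Det_finite_rank F = (\<Prod>\<mu> \<in> eigenvalues F - {0}. (1 + \<mu>) ^ alg_multiplicity F \<mu>)"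

text \<open>\<open>Det_I_plus T\<close> is \<open>Det (I + T)\<close> for \<open>T\<close> of trace class: the limit of \<open>Det (I + F)\<close> as \<open>F\<close>
  tends to \<open>T\<close> in trace norm through the finite rank operators.\<close>

definition Det_I_plus :: "('h::complex_hilbert \<Rightarrow> 'h) \<Rightarrow> complex" where
  "Det_I_plus T = (THE D. \<forall>\<epsilon>>0. \<exists>\<delta>>0. \<forall>F.
     finite_rank F \<and> trace_class (\<lambda>x. F x - T x) \<and> trace_norm (\<lambda>x. F x - T x) < \<delta>
       \<longrightarrow> dist (Det_finite_rank F) D < \<epsilon>)"


section \<open>Fourier multipliers and matrix symbols\<close>

text \<open>Here \<open>e j k\<close> with \<open>k < d j\<close> stands for \<open>e_j^{k+1}\<close>: matrix indices start at 0.\<close>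

definition component :: "(nat \<Rightarrow> nat \<Rightarrow> 'h::complex_hilbert) \<Rightarrow> (nat \<Rightarrow> nat) \<Rightarrow> nat \<Rightarrow> 'h set" where
  "component e d j = cspan (e j ` {..<d j})"

definition fourier_multiplier ::
  "(nat \<Rightarrow> nat \<Rightarrow> 'h::complex_hilbert) \<Rightarrow> (nat \<Rightarrow> nat) \<Rightarrow> ('h \<Rightarrow> 'h) \<Rightarrow> bool" where
  "fourier_multiplier e d T \<longleftrightarrow> (\<forall>j. T ` component e d j \<subseteq> component e d j)"

definition fourier_coeff :: "(nat \<Rightarrow> nat \<Rightarrow> 'h::complex_hilbert) \<Rightarrow> 'h \<Rightarrow> nat \<Rightarrow> nat \<Rightarrow> complex" where
  "fourier_coeff e f j k = cinner f (e j k)"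

definition matrix_symbol ::
  "(nat \<Rightarrow> nat \<Rightarrow> 'h::complex_hilbert) \<Rightarrow> (nat \<Rightarrow> nat) \<Rightarrow> ('h \<Rightarrow> 'h) \<Rightarrow> nat \<Rightarrow> complex Matrix.mat" where
  "matrix_symbol e d T l = Matrix.mat (d l) (d l) (\<lambda>(m, k). fourier_coeff e (T (e l k)) l m)"

definition mat_trace :: "'a::comm_monoid_add Matrix.mat \<Rightarrow> 'a" where
  "mat_trace A = (\<Sum>i<dim_row A. A $$ (i, i))"

lemma cinner_zero_left: "cinner 0 y = (0 :: complex)"
  using cinner_add_left[of 0 0 y] by simp

text \<open>The defining relation of the symbol, including the vanishing of the off-diagonal blocks.\<close>

lemma fourier_coeff_multiplier:
  assumes onb: "orthonormal_basis (\<lambda>(j, k). e j k) (SIGMA j:UNIV. {..<d j})"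
    and T: "fourier_multiplier e d T"
    and k: "k < d j" and m: "m < d l"
  shows "fourier_coeff e (T (e j k)) l m = (if j = l then matrix_symbol e d T l $$ (m, k) else 0)"
proof (cases "j = l")
  case True
  then show ?thesis using k m by (simp add: matrix_symbol_def)
next
  case False
  have orth: "cinner (e j i) (e l m) = 0" if "i < d j" for i
  proof -
    have "(j, i) \<in> (SIGMA j:UNIV. {..<d j})" "(l, m) \<in> (SIGMA j:UNIV. {..<d j})"
      using that m by auto
    with onb False show ?thesis unfolding orthonormal_basis_def by fastforce
  qed
  have "cinner x (e l m) = 0" if "x \<in> cspan (e j ` {..<d j})" for x
    using that
  proof (induction rule: complex_vector.span_induct_alt)
    case base
    show ?case by (rule cinner_zero_left)
  next
    case (step c x y)
    then show ?case using orth by (auto simp: cinner_add_left cinner_scaleC_left)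
  qed
  moreover have "e j k \<in> component e d j"
    unfolding component_def using k by (intro complex_vector.span_base) auto
  ultimately show ?thesis
    using T False unfolding fourier_multiplier_def fourier_coeff_def component_def by auto
qed

end

theory Submission
  imports Defs "HOL-Computational_Algebra.Fundamental_Theorem_Algebra"
begin

text \<open>The operators of finite rank close to \<open>z T\<close> in trace norm have operator norm less than \<open>1\<close> for
  small \<open>z\<close>, so the logarithmic series turns the product over the eigenvalues of such an \<open>F\<close> into
  \<open>exp (\<Sum>m. (-1)\<^sup>m\<^sup>+\<^sup>1 / m * Tr (F\<^sup>m))\<close>; that the eigenvalues, with algebraic multiplicity, have the
  traces as power sums is read off an orthonormal basis in which \<open>F\<close> is triangular.  Telescoping
  \<open>F\<^sup>m - (z T)\<^sup>m\<close> and the bound \<open>|Tr (X A Y)| \<le> \<parallel>X\<parallel> \<parallel>Y\<parallel> \<parallel>A\<parallel>\<^sub>1\<close>, which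
  comes from the singular value expansion of \<open>A\<close>, show that the exponent converges as \<open>F\<close> tends to
  \<open>z T\<close>; truncated singular value expansions show that there are such \<open>F\<close>.  Computed in the basis
  \<open>e j k\<close>, the trace of \<open>T\<^sup>m\<close> splits into the traces of the blocks \<open>\<sigma>\<^sub>T(l)\<^sup>m\<close>.\<close>

section \<open>Inner products and orthonormal families\<close>

text \<open>\<open>Det_I_plus\<close> is a definite description over all operators of finite rank
  near \<open>z T\<close>, so two things are owed: the exponential attracts the determinants of all
  of them, and they exist arbitrarily close, since otherwise every number would satisfy the
  description. These operators need not respect the decomposition, so their determinants cannot be
  read off blocks. The bridge is the trace, taken throughout as the diagonal sum in the given basis:
  for finite rank it agrees by Parseval with the sum over a triangular basis, and the traces of
  powers of \<open>z T\<close> are compared with it through differences. Each telescoped term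
  contains \<open>F - z T\<close> exactly once, and that operator is trace class by the definition
  of the limit. The constant 1/4 enters twice: \<open>z T\<close> has norm at most 1/4 and
  \<open>F\<close> stays within 1/4 of it, so both have norm at most 1/2 and the estimates add up to
  a geometric series.\<close>

lemma cinner_add_right: "cinner x (y + z) = cinner x y + cinner x (z :: 'h::complex_inner)"
  by (metis cinner_add_left cinner_commute complex_cnj_add)

lemma cinner_scaleC_right: "cinner x (a *\<^sub>C y) = cnj a * cinner x (y :: 'h::complex_inner)"
  by (metis cinner_commute cinner_scaleC_left complex_cnj_mult)

lemma cinner_zero_right [simp]: "cinner x 0 = 0" for x :: "'h::complex_hilbert"
  by (metis cinner_commute cinner_zero_left complex_cnj_zero)

declare cinner_zero_left [simp]

lemma scaleC_minus1: "(-1) *\<^sub>C x = - (x :: 'h::complex_inner)"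
  by (metis complex_vector.scale_minus_left scaleC_one)

lemma cinner_minus_left: "cinner (- x) y = - cinner x (y :: 'h::complex_inner)"
  by (metis cinner_scaleC_left mult_minus1 scaleC_minus1)

lemma cinner_minus_right: "cinner x (- y) = - cinner x (y :: 'h::complex_inner)"
  by (metis cinner_commute cinner_minus_left complex_cnj_minus)

lemma cinner_diff_left: "cinner (x - y) z = cinner x z - cinner y (z :: 'h::complex_inner)"
  by (metis cinner_add_left cinner_minus_left diff_conv_add_uminus)

lemma cinner_diff_right: "cinner x (y - z) = cinner x y - cinner x (z :: 'h::complex_inner)"
  by (metis cinner_add_right cinner_minus_right diff_conv_add_uminus)

lemma cinner_sum_left: "cinner (\<Sum>i\<in>I. f i) y = (\<Sum>i\<in>I. cinner (f i) y)"
  for y :: "'h::complex_hilbert"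
  by (induction I rule: infinite_finite_induct) (auto simp: cinner_add_left)

lemma cinner_sum_right: "cinner y (\<Sum>i\<in>I. f i) = (\<Sum>i\<in>I. cinner y (f i))"
  for y :: "'h::complex_hilbert"
  by (induction I rule: infinite_finite_induct) (auto simp: cinner_add_right)

lemmas cinner_simps = cinner_add_left cinner_add_right cinner_diff_left cinner_diff_right
  cinner_scaleC_left cinner_scaleC_right cinner_sum_left cinner_sum_right
  cinner_minus_left cinner_minus_right

lemma norm_sq_cinner: "(norm x)\<^sup>2 = Re (cinner x (x :: 'h::complex_inner))"
  by (simp add: cinner_self)

lemma norm_add_sq: "(norm (x + y))\<^sup>2 = (norm x)\<^sup>2 + (norm y)\<^sup>2 + 2 * Re (cinner x (y :: 'h::complex_inner))"
proof -
  have "Re (cinner y x) = Re (cinner x y)"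
    by (subst cinner_commute) simp
  then show ?thesis by (simp add: norm_sq_cinner cinner_simps)
qed

lemma norm_diff_sq: "(norm (x - y))\<^sup>2 = (norm x)\<^sup>2 + (norm y)\<^sup>2 - 2 * Re (cinner x (y :: 'h::complex_inner))"
  using norm_add_sq[of x "- y"] by (simp add: cinner_minus_right)

lemma norm_scaleC [simp]: "norm (a *\<^sub>C x) = cmod a * norm (x :: 'h::complex_inner)"
proof -
  have "complex_of_real ((norm (a *\<^sub>C x))\<^sup>2) = (a * cnj a) * cinner x x"
    unfolding cinner_self[symmetric] cinner_simps by simp
  also have "\<dots> = complex_of_real ((cmod a * norm x)\<^sup>2)"
    unfolding complex_norm_square[symmetric] cinner_self by (simp add: power_mult_distrib)
  finally have "(norm (a *\<^sub>C x))\<^sup>2 = (cmod a * norm x)\<^sup>2"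
    using of_real_eq_iff by blast
  then show ?thesis by simp
qed

lemma cauchy_schwarz: "cmod (cinner x y) \<le> norm x * norm (y :: 'h::complex_hilbert)"
proof (cases "y = 0")
  case False
  \<comment> \<open>The coefficient of the orthogonal projection of \<open>x\<close> onto the line
    of \<open>y\<close>.\<close>
  define t where "t = cinner x y / complex_of_real ((norm y)\<^sup>2)"
  have "0 \<le> (norm (x - t *\<^sub>C y))\<^sup>2" by simp
  also have "\<dots> = (norm x)\<^sup>2 + (cmod t)\<^sup>2 * (norm y)\<^sup>2 - 2 * Re (cnj t * cinner x y)"
    by (simp add: norm_diff_sq cinner_simps power_mult_distrib)
  also have "cnj t * cinner x y = complex_of_real ((cmod (cinner x y))\<^sup>2 / (norm y)\<^sup>2)"
    by (simp add: t_def complex_norm_square[symmetric] mult.commute)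
  also have "(cmod t)\<^sup>2 * (norm y)\<^sup>2 = (cmod (cinner x y))\<^sup>2 / (norm y)\<^sup>2"
    using False by (simp add: t_def norm_divide power_divide norm_mult power2_eq_square)
  finally have "(cmod (cinner x y))\<^sup>2 / (norm y)\<^sup>2 \<le> (norm x)\<^sup>2" by simp
  then have "(cmod (cinner x y))\<^sup>2 \<le> (norm x * norm y)\<^sup>2"
    using False by (simp add: field_simps power_mult_distrib)
  then show ?thesis by (rule power2_le_imp_le) simp
qed simp

lemma bounded_linear_cinner_left: "bounded_linear (\<lambda>x. cinner x (y :: 'h::complex_hilbert))"
  by (rule bounded_linear_intro[where K = "norm y"])
    (auto simp: cinner_simps scaleR_scaleC cauchy_schwarz scaleC_complex_def)

lemma bounded_linear_scaleC_right: "bounded_linear (\<lambda>x :: 'h::complex_hilbert. a *\<^sub>C x)"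
  by (rule bounded_linear_intro[where K = "cmod a"])
    (auto simp: scaleC_add_right scaleR_scaleC scaleC_scaleC mult.commute)

lemma cinner_eq_zeroI:
  assumes "\<And>y. cinner x y = 0"
  shows "x = (0 :: 'h::complex_hilbert)"
  using assms[of x] by (simp add: cinner_self)

lemma cinner_eqI:
  assumes "\<And>x. cinner x y = cinner x z"
  shows "y = (z :: 'h::complex_hilbert)"
  using assms[of "y - z"] cinner_eq_zeroI[of "y - z"]
  by (metis cinner_diff_right cinner_self eq_iff_diff_eq_0 norm_eq_zero of_real_eq_0_iff zero_eq_power2)

lemma cspan_cinner_zero:
  assumes "\<And>i. i \<in> J \<Longrightarrow> cinner x (b i) = 0" and "y \<in> cspan (b ` J)"
  shows "cinner x (y :: 'h::complex_hilbert) = 0"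
  using assms(2)
proof (induction rule: complex_vector.span_induct_alt)
  case (step c u v)
  then show ?case using assms(1) by (auto simp: cinner_simps)
qed simp

text \<open>Orthonormality without density and over any index set. It serves finite parts of the
  given basis, singular vectors, triangular bases, and plain sets of vectors, which are indexed by
  the identity.\<close>

definition orthonormal_on :: "('i \<Rightarrow> 'h::complex_hilbert) \<Rightarrow> 'i set \<Rightarrow> bool" where
  "orthonormal_on b I \<longleftrightarrow> (\<forall>i\<in>I. \<forall>j\<in>I. cinner (b i) (b j) = (if i = j then 1 else 0))"

lemma orthonormal_on_subset: "orthonormal_on b I \<Longrightarrow> J \<subseteq> I \<Longrightarrow> orthonormal_on b J"
  unfolding orthonormal_on_def by blast

lemma orthonormal_on_cinner:
  "orthonormal_on b I \<Longrightarrow> i \<in> I \<Longrightarrow> j \<in> I \<Longrightarrow> cinner (b i) (b j) = (if i = j then 1 else 0)"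
  unfolding orthonormal_on_def by blast

lemma orthonormal_on_norm: "orthonormal_on b I \<Longrightarrow> i \<in> I \<Longrightarrow> norm (b i) = 1"
  using orthonormal_on_cinner[of b I i i] norm_sq_cinner[of "b i"]
  by (simp add: power2_eq_1_iff) (smt (verit) norm_ge_zero)

lemma orthonormal_on_inj: "orthonormal_on b I \<Longrightarrow> inj_on b I"
  by (rule inj_onI) (metis orthonormal_on_cinner zero_neq_one)

lemma orthonormal_on_sum_cinner:
  assumes "orthonormal_on b J" "finite J" "j \<in> J"
  shows "cinner (\<Sum>i\<in>J. c i *\<^sub>C b i) (b j) = c j"
proof -
  have "cinner (\<Sum>i\<in>J. c i *\<^sub>C b i) (b j) = (\<Sum>i\<in>J. if i = j then c j else 0)"
    unfolding cinner_sum_left cinner_scaleC_left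
    using assms by (intro sum.cong) (auto simp: orthonormal_on_cinner)
  then show ?thesis using assms by simp
qed

definition ortho_proj :: "('i \<Rightarrow> 'h::complex_hilbert) \<Rightarrow> 'i set \<Rightarrow> 'h \<Rightarrow> 'h" where
  "ortho_proj b J x = (\<Sum>i\<in>J. cinner x (b i) *\<^sub>C b i)"

lemma ortho_proj_in_span: "ortho_proj b J x \<in> cspan (b ` J)"
  unfolding ortho_proj_def
  by (intro complex_vector.span_sum complex_vector.span_scale complex_vector.span_base) auto

lemma ortho_proj_diff: "ortho_proj b J (x - y) = ortho_proj b J x - ortho_proj b J y"
  by (simp add: ortho_proj_def cinner_simps complex_vector.scale_left_diff_distrib sum_subtractf)

lemma ortho_proj_orthogonal:
  assumes "orthonormal_on b J" "finite J" "j \<in> J"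
  shows "cinner (x - ortho_proj b J x) (b j) = 0"
  using orthonormal_on_sum_cinner[OF assms] by (simp add: ortho_proj_def cinner_diff_left)

text \<open>Pythagoras: the remainder is orthogonal to the span and hence to the projection, whose
  squared norm is the sum of the squared coefficients.\<close>

lemma norm_sq_ortho_proj:
  assumes "orthonormal_on b J" "finite J"
  shows "(norm x)\<^sup>2 = (norm (x - ortho_proj b J x))\<^sup>2 + (\<Sum>i\<in>J. (cmod (cinner x (b i)))\<^sup>2)"
proof -
  let ?p = "ortho_proj b J x"
  have 1: "cinner (x - ?p) ?p = 0"
    by (rule cspan_cinner_zero[OF ortho_proj_orthogonal[OF assms] ortho_proj_in_span])
  have "cinner ?p ?p = cinner x ?p" using 1 by (simp add: cinner_simps)
  also have "\<dots> = complex_of_real (\<Sum>i\<in>J. (cmod (cinner x (b i)))\<^sup>2)"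
    unfolding ortho_proj_def cinner_sum_right cinner_scaleC_right
    by (simp add: complex_norm_square mult.commute del: of_real_power)
  finally have "(norm ?p)\<^sup>2 = (\<Sum>i\<in>J. (cmod (cinner x (b i)))\<^sup>2)"
    by (simp add: norm_sq_cinner)
  with norm_add_sq[of "x - ?p" ?p] 1 show ?thesis by simp
qed

lemma bessel:
  assumes "orthonormal_on b J" "finite J"
  shows "(\<Sum>i\<in>J. (cmod (cinner x (b i)))\<^sup>2) \<le> (norm x)\<^sup>2"
  using norm_sq_ortho_proj[OF assms, of x] by simp

lemma norm_diff_ortho_proj_le:
  assumes "orthonormal_on b J" "finite J"
  shows "norm (x - ortho_proj b J x) \<le> norm x"
proof (rule power2_le_imp_le)
  have "0 \<le> (\<Sum>i\<in>J. (cmod (cinner x (b i)))\<^sup>2)" by (intro sum_nonneg) auto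
  then show "(norm (x - ortho_proj b J x))\<^sup>2 \<le> (norm x)\<^sup>2"
    using norm_sq_ortho_proj[OF assms, of x] by simp
qed simp

lemma ortho_proj_span:
  assumes "orthonormal_on b J" "finite J" "x \<in> cspan (b ` J)"
  shows "ortho_proj b J x = x"
proof -
  have "x - ortho_proj b J x \<in> cspan (b ` J)"
    using assms(3) ortho_proj_in_span by (rule complex_vector.span_diff)
  then have "cinner (x - ortho_proj b J x) (x - ortho_proj b J x) = 0"
    by (rule cspan_cinner_zero[rotated]) (rule ortho_proj_orthogonal[OF assms(1,2)])
  then show ?thesis by (simp add: cinner_self)
qed

text \<open>Cauchy-Schwarz for the two coefficient vectors, followed by Bessel. This is what bounds
  the contribution of one singular vector to a trace.\<close>

lemma sum_cinner_mult_le: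
  assumes "orthonormal_on b J" "finite J"
  shows "(\<Sum>i\<in>J. cmod (cinner x (b i)) * cmod (cinner y (b i))) \<le> norm x * norm y"
proof -
  have "(\<Sum>i\<in>J. cmod (cinner x (b i)) * cmod (cinner y (b i)))\<^sup>2
      \<le> (\<Sum>i\<in>J. (cmod (cinner x (b i)))\<^sup>2) * (\<Sum>i\<in>J. (cmod (cinner y (b i)))\<^sup>2)"
    by (rule Cauchy_Schwarz_ineq_sum)
  also have "\<dots> \<le> (norm x)\<^sup>2 * (norm y)\<^sup>2"
    by (intro mult_mono bessel[OF assms] sum_nonneg) auto
  finally have "(\<Sum>i\<in>J. cmod (cinner x (b i)) * cmod (cinner y (b i)))\<^sup>2 \<le> (norm x * norm y)\<^sup>2"
    by (simp add: power_mult_distrib)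
  then show ?thesis by (rule power2_le_imp_le) simp
qed

text \<open>The explicit form of \<open>u\<close> is part of the conclusion so that callers can
  place \<open>u\<close> in any subspace containing \<open>x\<close> and its projection, and can
  compute an operator at \<open>u\<close>.\<close>

lemma gram_schmidt_step:
  assumes "orthonormal_on b J" "finite J" "x \<notin> cspan (b ` J)"
  obtains c u where "norm u = 1" "\<And>i. i \<in> J \<Longrightarrow> cinner u (b i) = 0"
    "c \<noteq> 0" "u = c *\<^sub>C (x - ortho_proj b J x)"
proof
  let ?w = "x - ortho_proj b J x"
  have "?w \<noteq> 0" using assms(3) ortho_proj_in_span[of b J x] by auto
  then show "norm ((1 / complex_of_real (norm ?w)) *\<^sub>C ?w) = 1"
    "1 / complex_of_real (norm ?w) \<noteq> 0"
    by (auto simp: norm_divide)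
  show "cinner ((1 / complex_of_real (norm ?w)) *\<^sub>C ?w) (b i) = 0" if "i \<in> J" for i
    using ortho_proj_orthogonal[OF assms(1,2) that] by (simp add: cinner_scaleC_left)
qed simp

lemma orthonormal_on_insert:
  assumes "orthonormal_on b J" "norm (b n) = 1" "\<And>i. i \<in> J \<Longrightarrow> cinner (b n) (b i) = 0"
  shows "orthonormal_on b (insert n J)"
proof -
  have "cinner (b i) (b n) = 0" if "i \<in> J" for i
    using assms(3)[OF that] by (metis cinner_commute complex_cnj_zero)
  moreover have "cinner (b n) (b n) = 1"
    using assms(2) by (simp add: cinner_self)
  ultimately show ?thesis
    using assms(1,3) unfolding orthonormal_on_def by auto
qed

lemma orthonormal_basis_on: "orthonormal_basis b I \<Longrightarrow> orthonormal_on b I"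
  unfolding orthonormal_basis_def orthonormal_on_def by blast

text \<open>Convergence is along finite subsets because the index set of pairs has no preferred
  order. Density gives a finite combination \<open>y\<close> near \<open>x\<close>, and every
  projection onto a larger finite subfamily is at least as good an approximation as
  \<open>y\<close>.\<close>

lemma orthonormal_basis_expansion:
  assumes b: "orthonormal_basis b I"
  shows "((\<lambda>i. cinner x (b i) *\<^sub>C b i) has_sum x) I"
  unfolding has_sum_def tendsto_iff eventually_finite_subsets_at_top
proof (intro allI impI)
  fix \<epsilon> :: real
  assume "\<epsilon> > 0"
  moreover have "x \<in> closure (cspan (b ` I))" using b by (simp add: orthonormal_basis_def)
  ultimately obtain y where y: "y \<in> cspan (b ` I)" "dist y x < \<epsilon>"
    unfolding closure_approachable by blast
  obtain S where S: "finite S" "S \<subseteq> b ` I" "y \<in> cspan S"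
    using y(1) unfolding complex_vector.span_explicit by (auto intro: complex_vector.span_sum
      complex_vector.span_scale complex_vector.span_base that)
  obtain X where X: "finite X" "X \<subseteq> I" "S = b ` X"
    using finite_subset_image[OF S(1,2)] by blast
  show "\<exists>X. finite X \<and> X \<subseteq> I \<and> (\<forall>Y. finite Y \<and> X \<subseteq> Y \<and> Y \<subseteq> I \<longrightarrow>
      dist (\<Sum>i\<in>Y. cinner x (b i) *\<^sub>C b i) x < \<epsilon>)"
  proof (intro exI[of _ X] conjI allI impI X)
    fix Y
    assume Y: "finite Y \<and> X \<subseteq> Y \<and> Y \<subseteq> I"
    then have on: "orthonormal_on b Y"
      using orthonormal_basis_on[OF b] orthonormal_on_subset by blast
    have "y \<in> cspan (b ` Y)"
      using S X Y complex_vector.span_mono[of "b ` X" "b ` Y"] by blast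
    then have "ortho_proj b Y y = y" using on Y ortho_proj_span by blast
    \<comment> \<open>The projection fixes \<open>y\<close>, so the remainder of \<open>x\<close> is
      the remainder of \<open>x - y\<close>, and taking remainders does not increase the
      norm.\<close>
    then have "x - ortho_proj b Y x = (x - y) - ortho_proj b Y (x - y)"
      by (simp add: ortho_proj_diff)
    then have "norm (x - ortho_proj b Y x) \<le> norm (x - y)"
      using norm_diff_ortho_proj_le[OF on, of "x - y"] Y by (simp only:)
    then show "dist (\<Sum>i\<in>Y. cinner x (b i) *\<^sub>C b i) x < \<epsilon>"
      using y(2) unfolding ortho_proj_def by (simp add: dist_norm norm_minus_commute)
  qed
qed

lemma parseval:
  assumes "orthonormal_basis b I"
  shows "((\<lambda>i. cinner x (b i) * cinner (b i) y) has_sum cinner x y) I"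
  using has_sum_bounded_linear[OF bounded_linear_cinner_left orthonormal_basis_expansion[OF assms]]
  by (simp add: o_def cinner_scaleC_left)

section \<open>Bounded operators and adjoints\<close>

lemma bounded_clinear_linear: "bounded_clinear A \<Longrightarrow> bounded_linear A"
  by (simp add: bounded_clinear_def)

lemma bounded_clinear_scale: "bounded_clinear A \<Longrightarrow> A (c *\<^sub>C x) = c *\<^sub>C A x"
  by (simp add: bounded_clinear_def)

lemma bounded_clinear_0: "bounded_clinear A \<Longrightarrow> A 0 = 0"
  by (simp add: bounded_clinear_def bounded_linear.linear linear_0)

lemma bounded_clinear_add: "bounded_clinear A \<Longrightarrow> A (x + y) = A x + A y"
  by (simp add: bounded_clinear_def bounded_linear.linear linear_add)

lemma bounded_clinear_diff: "bounded_clinear A \<Longrightarrow> A (x - y) = A x - A y"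
  by (simp add: bounded_clinear_def bounded_linear.linear linear_diff)

lemma bounded_clinear_sum: "bounded_clinear A \<Longrightarrow> A (\<Sum>i\<in>I. f i) = (\<Sum>i\<in>I. A (f i))"
  by (simp add: bounded_clinear_def bounded_linear.linear linear_sum)

lemma bounded_clinear_onorm: "bounded_clinear A \<Longrightarrow> norm (A x) \<le> onorm A * norm x"
  by (simp add: bounded_clinear_def onorm)

lemma bounded_clinear_id: "bounded_clinear (\<lambda>x. x)"
  by (simp add: bounded_clinear_def bounded_linear_ident)

lemma bounded_clinear_comp:
  "bounded_clinear A \<Longrightarrow> bounded_clinear B \<Longrightarrow> bounded_clinear (\<lambda>x. A (B x))"
  by (simp add: bounded_clinear_def bounded_linear_compose)

lemma bounded_clinear_minus:
  "bounded_clinear A \<Longrightarrow> bounded_clinear B \<Longrightarrow> bounded_clinear (\<lambda>x. A x - B x)"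
  by (simp add: bounded_clinear_def bounded_linear_sub complex_vector.scale_right_diff_distrib)

lemma bounded_clinear_scaleC: "bounded_clinear A \<Longrightarrow> bounded_clinear (\<lambda>x. c *\<^sub>C A x)"
  by (auto simp: bounded_clinear_def scaleC_scaleC mult.commute
      intro: bounded_linear_compose[OF bounded_linear_scaleC_right])

lemma bounded_clinear_funpow: "bounded_clinear A \<Longrightarrow> bounded_clinear (A ^^ n)"
  by (induction n) (auto simp: bounded_clinear_id bounded_clinear_comp id_def o_def)

lemma bounded_clinear_ortho_proj: "bounded_clinear (ortho_proj b J)"
  unfolding bounded_clinear_def
proof (intro conjI allI)
  show "bounded_linear (ortho_proj b J)"
    unfolding ortho_proj_def
  proof (rule bounded_linear_sum)
    fix i
    show "bounded_linear (\<lambda>x. cinner x (b i) *\<^sub>C b i)"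
      by (rule bounded_linear_intro[where K = "norm (b i) * norm (b i)"])
        (auto simp: cinner_simps scaleC_add_left scaleR_scaleC scaleC_scaleC mult.assoc[symmetric]
          intro!: mult_right_mono cauchy_schwarz)
  qed
qed (simp add: ortho_proj_def cinner_simps complex_vector.scale_sum_right scaleC_scaleC)

text \<open>If \<open>f\<close> is represented by \<open>y\<close>, then
  \<open>(norm x)\<^sup>2 - 2 * Re (f x)\<close> equals
  \<open>(norm (x - y))\<^sup>2 - (norm y)\<^sup>2\<close>. So the representing vector is sought as
  the minimiser of this functional, which exists by completeness.\<close>

lemma riesz_representation:
  fixes f :: "'h::complex_hilbert \<Rightarrow> complex"
  assumes f: "bounded_linear f" and fs: "\<And>c x. f (c *\<^sub>C x) = c * f x"
  obtains y where "\<And>x. f x = cinner x y"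
proof -
  interpret f: bounded_linear f by (rule f)
  define g where "g x = (norm x)\<^sup>2 - 2 * Re (f x)" for x
  \<comment> \<open>Completing the square bounds the functional from below.\<close>
  have "- (onorm f)\<^sup>2 \<le> g x" for x
  proof -
    have "Re (f x) \<le> onorm f * norm x"
      using onorm[OF f, of x] complex_Re_le_cmod[of "f x"] by linarith
    moreover have "0 \<le> (norm x - onorm f)\<^sup>2" by simp
    ultimately show ?thesis by (simp add: g_def power2_eq_square algebra_simps)
  qed
  then have bdd: "bdd_below (range g)" by (intro bdd_belowI) blast
  define m where "m = Inf (range g)"
  have m_le: "m \<le> g x" for x
    unfolding m_def using bdd by (rule cInf_lower[rotated]) simp
  have "\<exists>x. g x < m + 1 / real (Suc n)" for n
    using cInf_lessD[of "range g" "m + 1 / real (Suc n)"] by (auto simp: m_def)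
  then obtain x where x: "\<And>n. g (x n) < m + 1 / real (Suc n)" by metis
  \<comment> \<open>The parallelogram law; the linear part of \<open>g\<close> cancels. It forces a
    minimising sequence to be Cauchy.\<close>
  have par: "(norm (u - v))\<^sup>2 = 2 * g u + 2 * g v - 4 * g ((1/2) *\<^sub>R (u + v))" for u v
  proof -
    have "(norm ((1/2) *\<^sub>R (u + v)))\<^sup>2 = (norm (u + v))\<^sup>2 / 4"
      unfolding norm_scaleR by (simp add: power_mult_distrib power_divide)
    moreover have "Re (f ((1/2) *\<^sub>R (u + v))) = (Re (f u) + Re (f v)) / 2"
      unfolding f.scaleR f.add by simp
    ultimately show ?thesis
      using norm_add_sq[of u v] norm_diff_sq[of u v] unfolding g_def by simp
  qed
  have dist_x: "(norm (x i - x j))\<^sup>2 \<le> 4 / real (Suc N)" if "N \<le> i" "N \<le> j" for i j N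
  proof -
    have "1 / real (Suc i) \<le> 1 / real (Suc N)" "1 / real (Suc j) \<le> 1 / real (Suc N)"
      using that by (auto simp: field_simps)
    then show ?thesis
      using par[of "x i" "x j"] x[of i] x[of j] m_le[of "(1/2) *\<^sub>R (x i + x j)"] by simp
  qed
  have "Cauchy x"
  proof (rule metric_CauchyI)
    fix \<epsilon> :: real
    assume \<epsilon>: "\<epsilon> > 0"
    then obtain N where N: "4 / real (Suc N) < \<epsilon>\<^sup>2"
      using reals_Archimedean[of "\<epsilon>\<^sup>2 / 4"] by (auto simp: field_simps)
    have "dist (x i) (x j) < \<epsilon>" if "N \<le> i" "N \<le> j" for i j
      using dist_x[OF that] N \<epsilon> unfolding dist_norm
      by (meson le_less_trans less_imp_le power2_less_imp_less)
    then show "\<exists>M. \<forall>i\<ge>M. \<forall>j\<ge>M. dist (x i) (x j) < \<epsilon>" by blast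
  qed
  then obtain y where y: "x \<longlonglongrightarrow> y"
    by (metis Cauchy_convergent_iff convergent_def)
  have "(\<lambda>n. g (x n)) \<longlonglongrightarrow> g y"
    unfolding g_def by (intro tendsto_intros y f.tendsto)
  moreover have "(\<lambda>n. m + 1 / real (Suc n)) \<longlonglongrightarrow> m + 0"
    by (intro tendsto_intros LIMSEQ_Suc[OF lim_1_over_n])
  ultimately have "g y \<le> m + 0"
    by (rule LIMSEQ_le) (use x in \<open>auto intro: less_imp_le\<close>)
  then have y_min: "g y \<le> g u" for u using m_le[of u] by simp
  have re: "Re (f h) = Re (cinner h y)" for h
  proof (rule ccontr)
    define a where "a = Re (cinner y h) - Re (f h)"
    assume "Re (f h) \<noteq> Re (cinner h y)"
    then have a: "a \<noteq> 0" unfolding a_def by (metis cinner_commute cnj.simps(1) eq_iff_diff_eq_0)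
    \<comment> \<open>The first variation at the minimiser \<open>y\<close> in direction
      \<open>h\<close>. For small \<open>t\<close> of sign opposite to \<open>a\<close> the linear
      term would win; the value of \<open>t\<close> used next has \<open>+ 1\<close> in its
      denominator to cover \<open>h = 0\<close>.\<close>
    have "0 \<le> t\<^sup>2 * (norm h)\<^sup>2 + 2 * t * a" for t
      using y_min[of "y + t *\<^sub>R h"] norm_add_sq[of y "t *\<^sub>R h"]
      by (simp add: g_def f.add fs a_def scaleR_scaleC cinner_simps power_mult_distrib algebra_simps)
    from this[of "- a / ((norm h)\<^sup>2 + 1)"]
    have "2 * a\<^sup>2 / ((norm h)\<^sup>2 + 1) \<le> a\<^sup>2 * (norm h)\<^sup>2 / ((norm h)\<^sup>2 + 1)\<^sup>2"
      by (simp add: power_divide power2_eq_square)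
    then have "2 * a\<^sup>2 * ((norm h)\<^sup>2 + 1) \<le> a\<^sup>2 * (norm h)\<^sup>2"
      by (simp add: power2_eq_square divide_simps split: if_splits)
    moreover have "a\<^sup>2 * (norm h)\<^sup>2 < 2 * a\<^sup>2 * ((norm h)\<^sup>2 + 1)"
    proof -
      have "0 < a\<^sup>2" using a by simp
      moreover have "0 \<le> a\<^sup>2 * (norm h)\<^sup>2" by simp
      ultimately show ?thesis by (simp add: algebra_simps add_pos_nonneg)
    qed
    ultimately show False by simp
  qed
  have "f h = cinner h y" for h
  proof (rule complex_eqI)
    show "Re (f h) = Re (cinner h y)" by (rule re)
    \<comment> \<open>Multiplying \<open>h\<close> by the imaginary unit turns imaginary parts into
      real parts, up to sign.\<close>
    show "Im (f h) = Im (cinner h y)"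
      using re[of "\<i> *\<^sub>C h"] by (simp add: fs cinner_simps)
  qed
  then show ?thesis by (rule that)
qed

text \<open>Discharges the description in \<open>cadjoint\<close>: Riesz, applied for each
  \<open>y\<close>, yields existence, and an inner product determines its second argument.\<close>

lemma cinner_cadjoint:
  assumes A: "bounded_clinear A"
  shows "cinner (A x) y = cinner x (cadjoint A y)"
proof -
  have "\<exists>z. \<forall>x. cinner (A x) y = cinner x z" for y
  proof (rule riesz_representation)
    show "bounded_linear (\<lambda>x. cinner (A x) y)"
      using bounded_linear_compose[OF bounded_linear_cinner_left bounded_clinear_linear[OF A]] .
  qed (auto simp: bounded_clinear_scale[OF A] cinner_simps)
  then obtain S where S: "\<And>x y. cinner (A x) y = cinner x (S y)" by metis
  have "cadjoint A = S"
    unfolding cadjoint_def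
  proof (rule the_equality)
    fix S'
    assume S': "\<forall>x y. cinner (A x) y = cinner x (S' y)"
    show "S' = S"
    proof
      fix y
      show "S' y = S y" by (rule cinner_eqI) (use S S' in metis)
    qed
  qed (use S in blast)
  then show ?thesis by (simp add: S)
qed

lemma cinner_cadjoint': "bounded_clinear A \<Longrightarrow> cinner (cadjoint A x) y = cinner x (A y)"
  by (metis cinner_cadjoint cinner_commute)

lemma cadjoint_eqI:
  assumes "bounded_clinear A" "\<And>x y. cinner (A x) y = cinner x (S y)"
  shows "cadjoint A = S"
proof
  fix y
  show "cadjoint A y = S y" by (rule cinner_eqI) (metis assms cinner_cadjoint)
qed

lemma norm_cadjoint_le:
  assumes A: "bounded_clinear A"
  shows "norm (cadjoint A x) \<le> onorm A * norm x"
proof -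
  let ?y = "cadjoint A x"
  have "(norm ?y)\<^sup>2 = cmod (cinner (A ?y) x)"
    by (simp add: cinner_cadjoint[OF A] cinner_self norm_power)
  also have "\<dots> \<le> norm (A ?y) * norm x" by (rule cauchy_schwarz)
  also have "\<dots> \<le> (onorm A * norm ?y) * norm x"
    by (intro mult_right_mono bounded_clinear_onorm A) auto
  finally have "norm ?y * norm ?y \<le> norm ?y * (onorm A * norm x)"
    by (simp add: power2_eq_square mult.assoc mult.left_commute)
  moreover have "0 \<le> onorm A * norm x"
    using onorm_pos_le[OF bounded_clinear_linear[OF A]] by simp
  ultimately show ?thesis
    by (metis linorder_not_less mult_le_cancel_left_pos norm_ge_zero order_le_less order_less_le_trans)
qed

lemma bounded_clinear_cadjoint:
  assumes A: "bounded_clinear A"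
  shows "bounded_clinear (cadjoint A)"
  unfolding bounded_clinear_def
proof (intro conjI allI)
  show sc: "cadjoint A (c *\<^sub>C x) = c *\<^sub>C cadjoint A x" for c x
    by (rule cinner_eqI) (simp add: cinner_cadjoint[OF A, symmetric] cinner_simps)
  show "bounded_linear (cadjoint A)"
  proof (rule bounded_linear_intro[where K = "onorm A"])
    show "cadjoint A (x + y) = cadjoint A x + cadjoint A y" for x y
      by (rule cinner_eqI) (simp add: cinner_cadjoint[OF A, symmetric] cinner_simps)
    show "norm (cadjoint A x) \<le> norm x * onorm A" for x
      using norm_cadjoint_le[OF A, of x] by (simp add: mult.commute)
  qed (simp add: scaleR_scaleC sc)
qed

section \<open>Singular value sequences\<close>

text \<open>Suppose \<open>s k > s' k\<close> at the first disagreement. By monotonicity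
  \<open>s'\<close> takes the value \<open>s k\<close> only before \<open>k\<close>, where both
  sequences agree, so \<open>s\<close> takes it at least once more. But both must take it as often
  as the dimension of the same eigenspace says.\<close>

lemma singular_value_seq_not_greater:
  assumes s: "singular_value_seq A s" and s': "singular_value_seq A s'"
    and eq: "\<And>j. j < k \<Longrightarrow> s j = s' j"
  shows "s k \<le> s' k"
proof (rule ccontr)
  assume less: "\<not> s k \<le> s' k"
  let ?L = "{j. s j = s k}" and ?L' = "{j. s' j = s k}"
  have "0 \<le> s' k" using s' by (simp add: singular_value_seq_def)
  with less have pos: "0 < s k" by simp
  have "j < k" if "s' j = s k" for j
    using s' that less unfolding singular_value_seq_def decseq_def by (metis linorder_not_less order_refl)
  then have "?L' \<subseteq> ?L - {k}" using eq by force
  then have "?L' \<subset> ?L" by blast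
  moreover have "finite ?L" using s pos by (simp add: singular_value_seq_def)
  ultimately have "card ?L' < card ?L" by (rule psubset_card_mono[rotated])
  moreover have "card ?L' = card ?L"
    using s s' pos by (simp add: singular_value_seq_def)
  ultimately show False by simp
qed

lemma singular_value_seq_unique:
  assumes "singular_value_seq A s" "singular_value_seq A s'"
  shows "s = s'"
proof
  fix k
  show "s k = s' k"
  proof (induction k rule: less_induct)
    case (less k)
    then show ?case
      using assms singular_value_seq_not_greater[of A s s' k] singular_value_seq_not_greater[of A s' s k]
      by (metis order_antisym)
  qed
qed

lemma singular_values_eq: "singular_value_seq A s \<Longrightarrow> singular_values A = s"
  unfolding singular_values_def by (rule the_equality) (auto intro: singular_value_seq_unique)

lemma trace_class_singular_values:
  assumes "trace_class A"
  shows "compact_operator A" "bounded_clinear A" "singular_value_seq A (singular_values A)"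
    "summable (singular_values A)"
  using assms singular_values_eq unfolding trace_class_def compact_operator_def by auto

lemma trace_classI:
  assumes "compact_operator A" "singular_value_seq A s" "summable s"
  shows "trace_class A" "trace_norm A = suminf s"
  using assms singular_values_eq[OF assms(2)] unfolding trace_class_def trace_norm_def by auto

lemma singular_value_seq_nonneg: "singular_value_seq A s \<Longrightarrow> 0 \<le> s k"
  by (simp add: singular_value_seq_def)

lemma trace_norm_nonneg: "trace_class A \<Longrightarrow> 0 \<le> trace_norm A"
  unfolding trace_norm_def
  using singular_value_seq_nonneg trace_class_singular_values(3,4) by (metis suminf_nonneg)

section \<open>Eigenspaces of \<open>A\<^sup>*A\<close> for compact \<open>A\<close>\<close>

lemma orthonormal_on_dim:
  assumes "orthonormal_on b J"
  shows "cdim (cspan (b ` J)) = card J"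
proof -
  have "\<not> complex_vector.dependent (b ` J)"
    unfolding complex_vector.dependent_def
  proof safe
    fix j
    assume j: "j \<in> J" "b j \<in> cspan (b ` J - {b j})"
    have "cinner (b j) (b j) = 0"
    proof (rule cspan_cinner_zero)
      show "b j \<in> cspan (b ` (J - {j}))"
        using j(2) complex_vector.span_mono[of "b ` J - {b j}" "b ` (J - {j})"] by blast
    qed (use assms j(1) in \<open>auto simp: orthonormal_on_cinner\<close>)
    then show False using assms j(1) by (simp add: orthonormal_on_cinner)
  qed
  then have "cdim (cspan (b ` J)) = card (b ` J)"
    by (rule complex_vector.dim_span_eq_card_independent)
  then show ?thesis using orthonormal_on_inj[OF assms] by (simp add: card_image)
qed

definition singular_space :: "('h::complex_hilbert \<Rightarrow> 'h) \<Rightarrow> real \<Rightarrow> 'h set" where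
  "singular_space A r = {x. cadjoint A (A x) = complex_of_real (r\<^sup>2) *\<^sub>C x}"

lemma singular_space_subspace:
  assumes "bounded_clinear A"
  shows "complex_vector.subspace (singular_space A r)"
proof -
  note [simp] = bounded_clinear_0 bounded_clinear_add bounded_clinear_scale
  have "bounded_clinear (cadjoint A)" by (rule bounded_clinear_cadjoint[OF assms])
  with assms show ?thesis
    unfolding complex_vector.subspace_def singular_space_def
    by (auto simp: scaleC_add_right scaleC_scaleC mult.commute)
qed

lemma norm_singular_space:
  assumes "bounded_clinear A" "x \<in> singular_space A r" "0 \<le> r"
  shows "norm (A x) = r * norm x"
proof -
  have "complex_of_real ((norm (A x))\<^sup>2) = cinner x (cadjoint A (A x))"
    using cinner_cadjoint[OF assms(1), of x "A x"] by (simp add: cinner_self)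
  also have "\<dots> = complex_of_real ((r * norm x)\<^sup>2)"
    using assms(2) by (simp add: singular_space_def cinner_simps cinner_self power_mult_distrib)
  finally have "(norm (A x))\<^sup>2 = (r * norm x)\<^sup>2" using of_real_eq_iff by blast
  then show ?thesis using assms(3) by (simp add: power2_eq_iff_nonneg)
qed

lemma singular_space_orthogonal:
  assumes A: "bounded_clinear A" and x: "x \<in> singular_space A r" and y: "y \<in> singular_space A t"
    and "r\<^sup>2 \<noteq> t\<^sup>2"
  shows "cinner x y = 0"
proof -
  have "complex_of_real (r\<^sup>2) * cinner x y = cinner (cadjoint A (A x)) y"
    using x by (simp add: singular_space_def cinner_simps)
  also have "\<dots> = cinner x (cadjoint A (A y))"
    by (simp add: cinner_cadjoint'[OF A] cinner_cadjoint[OF A])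
  also have "\<dots> = complex_of_real (t\<^sup>2) * cinner x y"
    using y by (simp add: singular_space_def cinner_simps)
  finally have "(complex_of_real (r\<^sup>2) - complex_of_real (t\<^sup>2)) * cinner x y = 0"
    by (simp add: algebra_simps)
  then show ?thesis using assms(4) by (metis mult_eq_0_iff of_real_eq_iff right_minus_eq)
qed

text \<open>Orthonormal vectors in the eigenspace of \<open>r\<^sup>2\<close> have images at mutual distance
  \<open>r * sqrt 2\<close>, so total boundedness of the image of the unit ball limits their number.\<close>

lemma card_orthonormal_singular_space:
  assumes A: "compact_operator A" and r: "0 < r"
  obtains N where "\<And>J. finite J \<Longrightarrow> orthonormal_on (\<lambda>x. x) J \<Longrightarrow> J \<subseteq> singular_space A r \<Longrightarrow> card J \<le> N"
proof -
  have A': "bounded_clinear A" using A by (simp add: compact_operator_def)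
  \<comment> \<open>With radius \<open>r / 2\<close>, two images in the same ball differ by less
    than \<open>r\<close>.\<close>
  obtain C where C: "finite C" "closure (A ` cball 0 1) \<subseteq> (\<Union>x\<in>C. ball x (r / 2))"
    using A r unfolding compact_operator_def compact_eq_totally_bounded by (meson half_gt_zero)
  show ?thesis
  proof
    fix J
    assume J: "finite J" "orthonormal_on (\<lambda>x. x) J" "J \<subseteq> singular_space A r"
    have "\<exists>c\<in>C. dist c (A x) < r / 2" if "x \<in> J" for x
    proof -
      have "A x \<in> closure (A ` cball 0 1)"
        using orthonormal_on_norm[OF J(2) that] closure_subset by fastforce
      then show ?thesis using C(2) by (auto simp: subset_iff)
    qed
    then obtain g where g: "\<And>x. x \<in> J \<Longrightarrow> g x \<in> C \<and> dist (g x) (A x) < r / 2" by metis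
    have "inj_on g J"
    proof (rule inj_onI, rule ccontr)
      fix x y
      assume xy: "x \<in> J" "y \<in> J" "g x = g y" "x \<noteq> y"
      have "(norm (x - y))\<^sup>2 = 2"
        using orthonormal_on_norm[OF J(2)] orthonormal_on_cinner[OF J(2) xy(1,2)] xy
        by (simp add: norm_diff_sq)
      moreover have "norm (A x - A y) = r * norm (x - y)"
      proof -
        have "x - y \<in> singular_space A r"
          using J(3) xy(1,2) by (intro complex_vector.subspace_diff singular_space_subspace[OF A']) auto
        then show ?thesis
          using norm_singular_space[OF A', of "x - y" r] r by (simp add: bounded_clinear_diff[OF A'])
      qed
      moreover have "norm (A x - A y) < r"
        using g[OF xy(1)] g[OF xy(2)] xy(3) dist_triangle_half_r[of "g x" "A x" r "A y"]
        by (simp add: dist_norm)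
      ultimately have "(norm (x - y))\<^sup>2 = 2" "norm (x - y) < 1" using r by auto
      then show False using power_le_one[of "norm (x - y)" 2] by simp
    qed
    then show "card J \<le> card C"
      using g C(1) by (intro card_inj_on_le[of g]) auto
  qed
qed

text \<open>Since \<open>cdim\<close> is also defined for infinite-dimensional spaces, finiteness
  has to come from compactness: it bounds the size of orthonormal sets in the eigenspace. A largest
  one spans, because a Gram-Schmidt step on a vector outside its span would enlarge it.\<close>

lemma singular_space_orthonormal:
  assumes A: "compact_operator A" and r: "0 < r"
  obtains J where "finite J" "orthonormal_on (\<lambda>x. x) J" "singular_space A r = cspan J"
proof -
  let ?E = "singular_space A r"
  have A': "bounded_clinear A" using A by (simp add: compact_operator_def)
  note sub = singular_space_subspace[OF A', of r]
  define P where "P J \<longleftrightarrow> finite J \<and> orthonormal_on (\<lambda>x. x) J \<and> J \<subseteq> ?E" for J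
  obtain N where N: "\<And>J. P J \<Longrightarrow> card J \<le> N"
    using card_orthonormal_singular_space[OF A r] unfolding P_def by metis
  have "P {}" by (simp add: P_def orthonormal_on_def)
  then obtain J where J: "P J" and max: "\<And>J'. P J' \<Longrightarrow> card J' \<le> card J"
    using ex_has_greatest_nat[of P "{}" card "Suc N"] N by (metis less_Suc_eq_le)
  have on: "orthonormal_on (\<lambda>x. x) J" "finite J" "J \<subseteq> ?E" using J by (auto simp: P_def)
  have "cspan J \<subseteq> ?E" using on(3) sub by (rule complex_vector.span_minimal)
  moreover have "x \<in> cspan J" if x: "x \<in> ?E" for x
  proof (rule ccontr)
    assume "x \<notin> cspan J"
    then have nx: "x \<notin> cspan ((\<lambda>x. x) ` J)" by simp
    obtain c u where u: "norm u = 1" "\<And>i. i \<in> J \<Longrightarrow> cinner u i = 0" "c \<noteq> 0"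
      "u = c *\<^sub>C (x - ortho_proj (\<lambda>x. x) J x)"
      using gram_schmidt_step[OF on(1,2) nx] by metis
    have "u \<in> ?E"
      using u(4) x \<open>cspan J \<subseteq> ?E\<close> ortho_proj_in_span[of "\<lambda>x. x" J x] sub
      by (auto intro!: complex_vector.subspace_scale complex_vector.subspace_diff)
    moreover have "orthonormal_on (\<lambda>x. x) (insert u J)"
      using on(1) u(1,2) by (intro orthonormal_on_insert) auto
    ultimately have "P (insert u J)" using on by (simp add: P_def)
    moreover have "u \<notin> J" using u(1) u(2)[of u] by (auto simp: cinner_self)
    ultimately show False using max[of "insert u J"] on(2) by simp
  qed
  ultimately have "?E = cspan J" by blast
  with on that show ?thesis by blast
qed

text \<open>Right singular vectors matched index by index with \<open>s\<close>. Where
  \<open>s k = 0\<close> the vector \<open>\<phi> k\<close> is unconstrained, hence the condition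
  \<open>0 < s k\<close> in the index sets of the projections below.\<close>

definition singular_family :: "('h::complex_hilbert \<Rightarrow> 'h) \<Rightarrow> (nat \<Rightarrow> real) \<Rightarrow> (nat \<Rightarrow> 'h) \<Rightarrow> bool" where
  "singular_family A s \<phi> \<longleftrightarrow> orthonormal_on \<phi> {k. 0 < s k} \<and>
     (\<forall>r>0. singular_space A r = cspan (\<phi> ` {k. s k = r}))"

text \<open>The level set of \<open>s\<close> at \<open>r\<close> is as large as an orthonormal
  basis of the eigenspace, so a bijection labels that basis. Eigenspaces of different values are
  orthogonal, so the labels fit together.\<close>

lemma singular_family_exists:
  assumes A: "compact_operator A" and s: "singular_value_seq A s"
  obtains \<phi> where "singular_family A s \<phi>"
proof -
  have A': "bounded_clinear A" using A by (simp add: compact_operator_def)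
  have "\<exists>f J. finite J \<and> orthonormal_on (\<lambda>x. x) J \<and> singular_space A r = cspan J \<and>
      bij_betw f {k. s k = r} J" if r: "0 < r" for r
  proof -
    obtain J where J: "finite J" "orthonormal_on (\<lambda>x. x) J" "singular_space A r = cspan J"
      using singular_space_orthonormal[OF A r] .
    have "card {k. s k = r} = cdim (singular_space A r)" "finite {k. s k = r}"
      using s r by (auto simp: singular_value_seq_def singular_space_def)
    moreover have "cdim (singular_space A r) = card J"
      using orthonormal_on_dim[OF J(2)] J(3) by simp
    ultimately show ?thesis using J finite_same_card_bij[of "{k. s k = r}" J] by metis
  qed
  then obtain f J where fJ: "\<And>r. 0 < r \<Longrightarrow> finite (J r) \<and> orthonormal_on (\<lambda>x. x) (J r) \<and>
      singular_space A r = cspan (J r) \<and> bij_betw (f r) {k. s k = r} (J r)"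
    by metis
  define \<phi> where "\<phi> k = f (s k) k" for k
  have \<phi>J: "\<phi> k \<in> J (s k)" if "0 < s k" for k
    using fJ[OF that] unfolding \<phi>_def bij_betw_def by blast
  have "orthonormal_on \<phi> {k. 0 < s k}"
    unfolding orthonormal_on_def
  proof safe
    fix i j
    assume ij: "0 < s i" "0 < s j"
    show "cinner (\<phi> i) (\<phi> j) = (if i = j then 1 else 0)"
    proof (cases "s i = s j")
      case True
      have "\<phi> i = \<phi> j \<longleftrightarrow> i = j"
        using fJ[OF ij(1)] True unfolding \<phi>_def bij_betw_def inj_on_def by auto
      then show ?thesis
        using fJ[OF ij(1)] \<phi>J[OF ij(1)] \<phi>J[OF ij(2)] True
        by (auto simp: orthonormal_on_def)
    next
      case False
      have "\<phi> i \<in> singular_space A (s i)" "\<phi> j \<in> singular_space A (s j)"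
        using ij fJ \<phi>J complex_vector.span_base by blast+
      then show ?thesis
        using False ij singular_space_orthogonal[OF A'] by auto
    qed
  qed
  moreover have "\<phi> ` {k. s k = r} = J r" if "0 < r" for r
  proof -
    have "\<phi> ` {k. s k = r} = f r ` {k. s k = r}" by (intro image_cong) (auto simp: \<phi>_def)
    then show ?thesis using fJ[OF that] by (simp add: bij_betw_def)
  qed
  ultimately show ?thesis using that fJ unfolding singular_family_def by metis
qed

lemma singular_family_mem:
  assumes "singular_family A s \<phi>" "0 < s k"
  shows "\<phi> k \<in> singular_space A (s k)"
  using assms complex_vector.span_base[of "\<phi> k" "\<phi> ` {j. s j = s k}"]
  unfolding singular_family_def by blast

text \<open>A maximising sequence for \<open>norm (A x)\<close> on the unit sphere of \<open>W\<close> converges, by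
  compactness, to an eigenvector of \<open>A\<^sup>*A\<close>.\<close>

lemma maximal_singular_vector:
  assumes A: "compact_operator A" and W: "complex_vector.subspace W" "closed W"
    and inv: "\<And>x. x \<in> W \<Longrightarrow> cadjoint A (A x) \<in> W"
    and nz: "x0 \<in> W" "A x0 \<noteq> 0"
  obtains r y where "0 < r" "y \<in> W" "y \<noteq> 0" "y \<in> singular_space A r"
    "\<And>x. x \<in> W \<Longrightarrow> norm (A x) \<le> r * norm x"
proof -
  have A': "bounded_clinear A" using A by (simp add: compact_operator_def)
  note Ad = bounded_clinear_cadjoint[OF A']
  let ?S = "(\<lambda>x. norm (A x)) ` (W \<inter> sphere 0 1)"
  define r where "r = Sup ?S"
  have bdd: "bdd_above ?S"
  proof (rule bdd_aboveI)
    fix t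
    assume "t \<in> ?S"
    then obtain x where "t = norm (A x)" "norm x = 1" by auto
    then show "t \<le> onorm A" using bounded_clinear_onorm[OF A', of x] by simp
  qed
  have scaled: "(1 / complex_of_real (norm x)) *\<^sub>C x \<in> W \<inter> sphere 0 1" if "x \<in> W" "x \<noteq> 0" for x
    using that complex_vector.subspace_scale[OF W(1)] by (auto simp: norm_divide)
  have bound: "norm (A x) \<le> r * norm x" if x: "x \<in> W" for x
  proof (cases "x = 0")
    case False
    have "norm (A ((1 / complex_of_real (norm x)) *\<^sub>C x)) \<le> r"
      unfolding r_def by (rule cSup_upper[OF imageI[OF scaled[OF x False]] bdd])
    then show ?thesis
      using False by (simp add: bounded_clinear_scale[OF A'] norm_divide field_simps)
  qed (simp add: bounded_clinear_0[OF A'])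
  have x0: "x0 \<noteq> 0" using nz bounded_clinear_0[OF A'] by auto
  have "0 < norm (A x0)" using nz by simp
  also have "\<dots> \<le> r * norm x0" by (rule bound[OF nz(1)])
  finally have r: "0 < r" using x0 by (simp add: zero_less_mult_iff)
  have "\<exists>x\<in>W \<inter> sphere 0 1. r - 1 / real (Suc n) < norm (A x)" for n
  proof -
    have "?S \<noteq> {}" using scaled[OF nz(1) x0] by blast
    moreover have "r - 1 / real (Suc n) < Sup ?S" unfolding r_def[symmetric] by simp
    ultimately show ?thesis using less_cSup_iff[OF _ bdd] by auto
  qed
  then obtain x where x: "\<And>n. x n \<in> W" "\<And>n. norm (x n) = 1"
    "\<And>n. r - 1 / real (Suc n) < norm (A (x n))"
    by (metis IntE mem_sphere_0)
  have Ax: "norm (A (x n)) \<le> r" for n using bound[OF x(1)[of n]] x(2) by simp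
  have "A (x n) \<in> closure (A ` cball 0 1)" for n
    using x(2)[of n] closure_subset[of "A ` cball 0 1"] by auto
  then obtain l f where f: "strict_mono f" and l: "(\<lambda>n. A (x (f n))) \<longlonglongrightarrow> l"
    using A unfolding compact_operator_def compact_def comp_def
    by (elim conjE allE[of _ "\<lambda>n. A (x n)"]) blast
  have lim_norm: "(\<lambda>n. norm (A (x n))) \<longlonglongrightarrow> r"
  proof (rule real_tendsto_sandwich)
    have "(\<lambda>n. r - 1 / real (Suc n)) \<longlonglongrightarrow> r - 0"
      by (intro tendsto_intros LIMSEQ_Suc[OF lim_1_over_n])
    then show "(\<lambda>n. r - 1 / real (Suc n)) \<longlonglongrightarrow> r" by simp
    show "\<forall>\<^sub>F n in sequentially. r - 1 / real (Suc n) \<le> norm (A (x n))"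
      using x(3) by (intro always_eventually allI less_imp_le)
  qed (use Ax in auto)
  let ?B = "\<lambda>x. cadjoint A (A x)"
  have B_bound: "norm (?B u) \<le> r\<^sup>2 * norm u" if u: "u \<in> W" for u
  proof -
    have "(norm (?B u))\<^sup>2 = cmod (cinner (A u) (A (?B u)))"
      by (simp add: cinner_cadjoint[OF A'] cinner_self norm_power cinner_cadjoint'[OF A', symmetric])
    also have "\<dots> \<le> norm (A u) * norm (A (?B u))" by (rule cauchy_schwarz)
    also have "\<dots> \<le> (r * norm u) * (r * norm (?B u))"
      using r by (intro mult_mono bound u inv) auto
    finally have "norm (?B u) * norm (?B u) \<le> (r\<^sup>2 * norm u) * norm (?B u)"
      by (simp add: power2_eq_square algebra_simps)
    then show ?thesis
      by (cases "?B u = 0") auto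
  qed
  \<comment> \<open>Expanding the square gives the squared norm of \<open>?B (x n)\<close>, at most
    \<open>r ^ 4\<close> by \<open>B_bound\<close>, plus \<open>r ^ 4\<close>, minus
    \<open>2 * r\<^sup>2 * (norm (A (x n)))\<^sup>2\<close>. Along a maximising sequence this tends
    to 0.\<close>
  have key: "(norm (?B (x n) - complex_of_real (r\<^sup>2) *\<^sub>C x n))\<^sup>2 \<le> 2 * r\<^sup>2 * (r\<^sup>2 - (norm (A (x n)))\<^sup>2)" for n
  proof -
    have "(norm (?B (x n)))\<^sup>2 \<le> (r\<^sup>2)\<^sup>2"
      using B_bound[OF x(1)[of n]] x(2)[of n] by (intro power_mono) auto
    moreover have "Re (cinner (?B (x n)) (x n)) = (norm (A (x n)))\<^sup>2"
      by (simp add: cinner_cadjoint'[OF A'] norm_sq_cinner)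
    then have re: "Re (cinner (?B (x n)) (complex_of_real (r\<^sup>2) *\<^sub>C x n)) = r\<^sup>2 * (norm (A (x n)))\<^sup>2"
      by (simp add: cinner_scaleC_right flip: of_real_power)
    have nr: "norm (complex_of_real (r\<^sup>2) *\<^sub>C x n) = r\<^sup>2"
      using x(2)[of n] by (simp add: norm_power)
    have eq: "2 * r\<^sup>2 * (r\<^sup>2 - t) = (r\<^sup>2)\<^sup>2 + (r\<^sup>2)\<^sup>2 - 2 * (r\<^sup>2 * t)" for t
      by (simp add: algebra_simps power2_eq_square)
    ultimately show ?thesis
      unfolding norm_diff_sq re nr eq by linarith
  qed
  have "(\<lambda>n. 2 * r\<^sup>2 * (r\<^sup>2 - (norm (A (x n)))\<^sup>2)) \<longlonglongrightarrow> 2 * r\<^sup>2 * (r\<^sup>2 - r\<^sup>2)"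
    by (intro tendsto_intros lim_norm)
  then have "(\<lambda>n. 2 * r\<^sup>2 * (r\<^sup>2 - (norm (A (x n)))\<^sup>2)) \<longlonglongrightarrow> 0" by simp
  then have "(\<lambda>n. (norm (?B (x n) - complex_of_real (r\<^sup>2) *\<^sub>C x n))\<^sup>2) \<longlonglongrightarrow> 0"
    by (rule Lim_null_comparison[rotated]) (use key in \<open>auto intro!: always_eventually\<close>)
  then have "(\<lambda>n. sqrt ((norm (?B (x n) - complex_of_real (r\<^sup>2) *\<^sub>C x n))\<^sup>2)) \<longlonglongrightarrow> sqrt 0"
    by (intro tendsto_intros)
  then have "(\<lambda>n. ?B (x n) - complex_of_real (r\<^sup>2) *\<^sub>C x n) \<longlonglongrightarrow> 0"
    by (simp add: tendsto_norm_zero_iff)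
  then have "(\<lambda>n. ?B (x (f n)) - complex_of_real (r\<^sup>2) *\<^sub>C x (f n)) \<longlonglongrightarrow> 0"
    using LIMSEQ_subseq_LIMSEQ[OF _ f] by (fastforce simp: o_def)
  then have "(\<lambda>n. ?B (x (f n)) - (?B (x (f n)) - complex_of_real (r\<^sup>2) *\<^sub>C x (f n))) \<longlonglongrightarrow> cadjoint A l - 0"
    using bounded_linear.tendsto[OF bounded_clinear_linear[OF Ad] l] by (intro tendsto_diff)
  then have lim1: "(\<lambda>n. complex_of_real (r\<^sup>2) *\<^sub>C x (f n)) \<longlonglongrightarrow> cadjoint A l" by simp
  \<comment> \<open>Along the subsequence \<open>?B (x (f n))\<close> tends to
    \<open>cadjoint A l\<close> and differs from \<open>r\<^sup>2\<close> times
    \<open>x (f n)\<close> by a null sequence; so \<open>y\<close> is the limit of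
    \<open>x (f n)\<close> itself.\<close>
  define y where "y = (1 / complex_of_real (r\<^sup>2)) *\<^sub>C cadjoint A l"
  have "(\<lambda>n. (1 / complex_of_real (r\<^sup>2)) *\<^sub>C (complex_of_real (r\<^sup>2) *\<^sub>C x (f n))) \<longlonglongrightarrow> y"
    unfolding y_def by (rule bounded_linear.tendsto[OF bounded_linear_scaleC_right lim1])
  then have xy: "(\<lambda>n. x (f n)) \<longlonglongrightarrow> y" using r by (simp add: scaleC_scaleC scaleC_one)
  have "y \<in> W" using closed_sequentially[OF W(2) _ xy] x(1) by blast
  moreover have "norm y = 1"
    using tendsto_norm[OF xy] x(2) by (simp add: LIMSEQ_const_iff)
  then have "y \<noteq> 0" by auto
  moreover have "y \<in> singular_space A r"
  proof -
    have "(\<lambda>n. A (x (f n))) \<longlonglongrightarrow> A y"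
      by (rule bounded_linear.tendsto[OF bounded_clinear_linear[OF A'] xy])
    then have "l = A y" using l LIMSEQ_unique by blast
    then show ?thesis
      using r by (simp add: singular_space_def y_def scaleC_scaleC scaleC_one)
  qed
  ultimately show ?thesis using that r bound by blast
qed

text \<open>The vectors orthogonal to the first \<open>n\<close> singular vectors form a closed
  subspace invariant under \<open>cadjoint A\<close> after \<open>A\<close>. The supremum
  \<open>r\<close> of \<open>A\<close> on its unit sphere is attained at an eigenvector
  \<open>y\<close>. If \<open>s\<close> took the value \<open>r\<close> only before index
  \<open>n\<close>, then \<open>y\<close> would lie in the span of vectors to which it is
  orthogonal; so \<open>r\<close> is at most \<open>s n\<close>.\<close>

lemma norm_le_singular_value:
  assumes A: "compact_operator A" and s: "singular_value_seq A s" and \<phi>: "singular_family A s \<phi>"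
    and x: "\<And>k. k < n \<Longrightarrow> 0 < s k \<Longrightarrow> cinner x (\<phi> k) = 0"
  shows "norm (A x) \<le> s n * norm x"
proof (cases "A x = 0")
  case True
  then show ?thesis using singular_value_seq_nonneg[OF s] by simp
next
  case False
  have A': "bounded_clinear A" using A by (simp add: compact_operator_def)
  define W where "W = {x. \<forall>k. k < n \<and> 0 < s k \<longrightarrow> cinner x (\<phi> k) = 0}"
  have W1: "complex_vector.subspace W"
    by (auto simp: W_def complex_vector.subspace_def cinner_simps)
  have "closed (\<Inter>k\<in>{k. k < n \<and> 0 < s k}. {x. cinner x (\<phi> k) = 0})"
    by (intro closed_INT ballI closed_Collect_eq
        bounded_linear.continuous_on[OF bounded_linear_cinner_left] continuous_intros)
  then have W2: "closed W" unfolding W_def by (rule back_subst[where P = closed]) auto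
  have W3: "cadjoint A (A u) \<in> W" if u: "u \<in> W" for u
    unfolding W_def
  proof safe
    fix k
    assume k: "k < n" "0 < s k"
    then have "cadjoint A (A (\<phi> k)) = complex_of_real ((s k)\<^sup>2) *\<^sub>C \<phi> k"
      using singular_family_mem[OF \<phi>, of k] by (simp add: singular_space_def)
    then have "cinner (cadjoint A (A u)) (\<phi> k) = cnj (complex_of_real ((s k)\<^sup>2)) * cinner u (\<phi> k)"
      by (simp add: cinner_cadjoint'[OF A'] cinner_cadjoint[OF A'] cinner_scaleC_right)
    then show "cinner (cadjoint A (A u)) (\<phi> k) = 0" using u k by (simp add: W_def)
  qed
  have xW: "x \<in> W" using x by (simp add: W_def)
  obtain r y where r: "0 < r" and y: "y \<in> W" "y \<noteq> 0" "y \<in> singular_space A r"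
    and bound: "\<And>x. x \<in> W \<Longrightarrow> norm (A x) \<le> r * norm x"
    using maximal_singular_vector[OF A W1 W2 W3 xW False] by metis
  have "\<exists>k\<ge>n. s k = r"
  proof (rule ccontr)
    assume "\<not> (\<exists>k\<ge>n. s k = r)"
    then have "k < n" if "s k = r" for k using that by (auto simp flip: not_le)
    then have "cinner y (\<phi> k) = 0" if "k \<in> {k. s k = r}" for k
      using that y(1) r by (auto simp: W_def)
    moreover have "y \<in> cspan (\<phi> ` {k. s k = r})"
      using y(3) \<phi> r by (simp add: singular_family_def)
    ultimately have "cinner y y = 0" by (rule cspan_cinner_zero)
    then show False using y(2) by (simp add: cinner_self)
  qed
  then have "r \<le> s n" using s unfolding singular_value_seq_def decseq_def by blast
  then have "r * norm x \<le> s n * norm x" by (rule mult_right_mono) simp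
  with bound[OF xW] show ?thesis by linarith
qed

lemma norm_le_trace_norm:
  assumes "trace_class A"
  shows "norm (A x) \<le> trace_norm A * norm x"
proof -
  note s = trace_class_singular_values[OF assms]
  obtain \<phi> where \<phi>: "singular_family A (singular_values A) \<phi>"
    using singular_family_exists[OF s(1,3)] .
  have "norm (A x) \<le> singular_values A 0 * norm x"
    by (rule norm_le_singular_value[OF s(1,3) \<phi>]) simp
  also have "singular_values A 0 \<le> trace_norm A"
    unfolding trace_norm_def
    using sum_le_suminf[OF s(4), of "{0}"] singular_value_seq_nonneg[OF s(3)] by simp
  then have "singular_values A 0 * norm x \<le> trace_norm A * norm x" by (rule mult_right_mono) simp
  finally show ?thesis .
qed

section \<open>Trace estimates\<close>

text \<open>Each \<open>Y (b i)\<close> is split along the first \<open>n\<close> singular vectors.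
  The projected part is summed over \<open>i\<close> before \<open>k\<close>, and each
  \<open>k\<close> costs at most \<open>onorm X * onorm Y * s k\<close>. The remainder is shrunk by
  \<open>A\<close> to at most \<open>s n\<close> times its norm, and \<open>s n\<close> tends to 0.
  The bound is uniform in \<open>J\<close>, which later gives absolute convergence of the diagonal
  sum.\<close>

lemma sum_cinner_le_trace_norm:
  assumes A: "trace_class A" and X: "bounded_clinear X" and Y: "bounded_clinear Y"
    and b: "orthonormal_on b J" "finite J"
  shows "(\<Sum>i\<in>J. cmod (cinner (X (A (Y (b i)))) (b i))) \<le> onorm X * onorm Y * trace_norm A"
proof -
  define s where "s = singular_values A"
  have A': "bounded_clinear A" and s: "compact_operator A" "singular_value_seq A s" "summable s"
    using trace_class_singular_values[OF A] by (auto simp: s_def)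
  obtain \<phi> where \<phi>: "singular_family A s \<phi>" using singular_family_exists[OF s(1,2)] .
  note nonneg = singular_value_seq_nonneg[OF s(2)]
  define u where "u i = Y (b i)" for i
  define w where "w i = cadjoint X (b i)" for i
  \<comment> \<open>Finite because \<open>J\<close> is, and independent of the cut-off
    \<open>n\<close>.\<close>
  define C where "C = (\<Sum>i\<in>J. norm (u i) * norm (w i))"
  have Xn: "0 \<le> onorm X" "0 \<le> onorm Y"
    using X Y by (auto intro: onorm_pos_le bounded_clinear_linear)
  have est: "(\<Sum>i\<in>J. cmod (cinner (X (A (Y (b i)))) (b i))) \<le> onorm X * onorm Y * suminf s + s n * C" for n
  proof -
    define K where "K = {k. k < n \<and> 0 < s k}"
    have K: "finite K" "orthonormal_on \<phi> K"
      using \<phi> orthonormal_on_subset[of \<phi> "{k. 0 < s k}" K] by (auto simp: K_def singular_family_def)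
    have pointwise: "cmod (cinner (X (A (Y (b i)))) (b i)) \<le>
        (\<Sum>k\<in>K. cmod (cinner (u i) (\<phi> k)) * cmod (cinner (A (\<phi> k)) (w i))) + s n * (norm (u i) * norm (w i))" for i
    proof -
      let ?r = "u i - ortho_proj \<phi> K (u i)"
      have "norm (A ?r) \<le> s n * norm ?r"
        by (rule norm_le_singular_value[OF s(1,2) \<phi>])
          (use ortho_proj_orthogonal[OF K(2,1)] in \<open>auto simp: K_def\<close>)
      also have "\<dots> \<le> s n * norm (u i)"
        by (intro mult_left_mono norm_diff_ortho_proj_le K nonneg)
      finally have r: "norm (A ?r) * norm (w i) \<le> s n * norm (u i) * norm (w i)"
        by (rule mult_right_mono) simp
      have "A (u i) = A (ortho_proj \<phi> K (u i)) + A ?r"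
        by (simp add: bounded_clinear_diff[OF A'])
      also have "A (ortho_proj \<phi> K (u i)) = (\<Sum>k\<in>K. cinner (u i) (\<phi> k) *\<^sub>C A (\<phi> k))"
        by (simp add: ortho_proj_def bounded_clinear_sum[OF A'] bounded_clinear_scale[OF A'])
      finally have "cinner (A (u i)) (w i) =
          (\<Sum>k\<in>K. cinner (u i) (\<phi> k) * cinner (A (\<phi> k)) (w i)) + cinner (A ?r) (w i)"
        by (simp add: cinner_simps)
      moreover have "cinner (X (A (Y (b i)))) (b i) = cinner (A (u i)) (w i)"
        by (simp add: u_def w_def cinner_cadjoint[OF X])
      ultimately have "cmod (cinner (X (A (Y (b i)))) (b i)) \<le>
          cmod (\<Sum>k\<in>K. cinner (u i) (\<phi> k) * cinner (A (\<phi> k)) (w i)) + cmod (cinner (A ?r) (w i))"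
        by (simp add: norm_triangle_ineq)
      also have "\<dots> \<le> (\<Sum>k\<in>K. cmod (cinner (u i) (\<phi> k) * cinner (A (\<phi> k)) (w i))) + norm (A ?r) * norm (w i)"
        by (intro add_mono norm_sum cauchy_schwarz)
      finally show ?thesis using r by (simp add: norm_mult mult.assoc)
    qed
    \<comment> \<open>Moving \<open>Y\<close> and \<open>X\<close> across the inner product makes
      both factors coefficients with respect to \<open>b\<close> of two fixed vectors, so
      Cauchy-Schwarz and Bessel apply.\<close>
    have inner: "(\<Sum>i\<in>J. cmod (cinner (u i) (\<phi> k)) * cmod (cinner (A (\<phi> k)) (w i))) \<le> onorm X * onorm Y * s k"
      if k: "k \<in> K" for k
    proof -
      have "norm (\<phi> k) = 1" using orthonormal_on_norm[OF K(2) k] .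
      moreover have "norm (A (\<phi> k)) = s k * norm (\<phi> k)"
        using norm_singular_space[OF A' singular_family_mem[OF \<phi>, of k]] k by (auto simp: K_def)
      ultimately have n1: "norm (\<phi> k) = 1" "norm (A (\<phi> k)) = s k" by auto
      have "cmod (cinner (u i) (\<phi> k)) = cmod (cinner (cadjoint Y (\<phi> k)) (b i))" for i
        unfolding u_def cinner_cadjoint[OF Y] by (metis cinner_commute complex_mod_cnj)
      moreover have "cinner (A (\<phi> k)) (w i) = cinner (X (A (\<phi> k))) (b i)" for i
        by (simp add: w_def cinner_cadjoint[OF X])
      ultimately have "(\<Sum>i\<in>J. cmod (cinner (u i) (\<phi> k)) * cmod (cinner (A (\<phi> k)) (w i)))
          \<le> norm (cadjoint Y (\<phi> k)) * norm (X (A (\<phi> k)))"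
        using sum_cinner_mult_le[OF b] by simp
      also have "\<dots> \<le> (onorm Y * norm (\<phi> k)) * (onorm X * norm (A (\<phi> k)))"
        using Xn by (intro mult_mono norm_cadjoint_le Y bounded_clinear_onorm X) auto
      finally show ?thesis by (simp add: n1 mult_ac)
    qed
    have "(\<Sum>i\<in>J. cmod (cinner (X (A (Y (b i)))) (b i))) \<le>
        (\<Sum>i\<in>J. (\<Sum>k\<in>K. cmod (cinner (u i) (\<phi> k)) * cmod (cinner (A (\<phi> k)) (w i))) + s n * (norm (u i) * norm (w i)))"
      by (intro sum_mono pointwise)
    also have "\<dots> = (\<Sum>k\<in>K. \<Sum>i\<in>J. cmod (cinner (u i) (\<phi> k)) * cmod (cinner (A (\<phi> k)) (w i))) + s n * C"
      unfolding C_def sum.distrib sum_distrib_left by (subst sum.swap) simp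
    also have "\<dots> \<le> (\<Sum>k\<in>K. onorm X * onorm Y * s k) + s n * C"
      by (intro add_right_mono sum_mono inner)
    also have "(\<Sum>k\<in>K. onorm X * onorm Y * s k) \<le> onorm X * onorm Y * suminf s"
      unfolding sum_distrib_left[symmetric]
      using Xn nonneg by (intro mult_left_mono sum_le_suminf s K) auto
    finally show ?thesis by simp
  qed
  have "(\<lambda>n. onorm X * onorm Y * suminf s + s n * C) \<longlonglongrightarrow> onorm X * onorm Y * suminf s + 0 * C"
    by (intro tendsto_intros summable_LIMSEQ_zero s)
  from LIMSEQ_le_const[OF this] est show ?thesis
    unfolding s_def trace_norm_def by simp
qed

section \<open>Approximation in trace norm by operators of finite rank\<close>

lemma cinner_ortho_proj_commute: "cinner (ortho_proj b J x) y = cinner x (ortho_proj b J y)"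
proof -
  have "cinner (b i) y = cnj (cinner y (b i))" for i by (rule cinner_commute)
  then show ?thesis by (simp add: ortho_proj_def cinner_simps mult.commute)
qed

lemma compact_operator_contraction:
  assumes A: "compact_operator A" and P: "bounded_clinear P" and le: "\<And>x. norm (P x) \<le> norm x"
  shows "compact_operator (\<lambda>x. A (P x))"
proof -
  have "(\<lambda>x. A (P x)) ` cball 0 1 \<subseteq> A ` cball 0 1"
    using le by (force intro: order_trans)
  then have "closure ((\<lambda>x. A (P x)) ` cball 0 1) \<subseteq> closure (A ` cball 0 1)"
    by (rule closure_mono)
  moreover have "compact (closure (A ` cball 0 1))" using A by (simp add: compact_operator_def)
  ultimately have "compact (closure ((\<lambda>x. A (P x)) ` cball 0 1))"
    by (metis closed_closure compact_Int_closed inf.absorb2)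
  then show ?thesis
    using A P by (simp add: compact_operator_def bounded_clinear_comp)
qed

lemma compact_operator_scaleC:
  assumes A: "compact_operator A"
  shows "compact_operator (\<lambda>x. c *\<^sub>C A x)"
proof -
  have "compact ((\<lambda>x. c *\<^sub>C x) ` closure (A ` cball 0 1))"
    using A linear_continuous_on[OF bounded_linear_scaleC_right]
    by (intro compact_continuous_image) (auto simp: compact_operator_def)
  moreover have "(\<lambda>x. c *\<^sub>C A x) ` cball 0 1 \<subseteq> (\<lambda>x. c *\<^sub>C x) ` closure (A ` cball 0 1)"
    using closure_subset by fastforce
  ultimately have "compact (closure ((\<lambda>x. c *\<^sub>C A x) ` cball 0 1))"
    by (metis closed_closure closure_minimal compact_Int_closed compact_imp_closed inf.absorb2)
  then show ?thesis
    using A by (simp add: compact_operator_def bounded_clinear_scaleC)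
qed

lemma singular_value_seq_scaleC:
  assumes A: "bounded_clinear A" and s: "singular_value_seq A s"
  shows "singular_value_seq (\<lambda>x. c *\<^sub>C A x) (\<lambda>k. cmod c * s k)"
proof -
  have "cadjoint (\<lambda>x. c *\<^sub>C A x) = (\<lambda>x. cnj c *\<^sub>C cadjoint A x)"
    by (rule cadjoint_eqI[OF bounded_clinear_scaleC[OF A]])
      (simp add: cinner_simps cinner_cadjoint[OF A])
  then have B: "cadjoint (\<lambda>x. c *\<^sub>C A x) (c *\<^sub>C A x) = complex_of_real ((cmod c)\<^sup>2) *\<^sub>C cadjoint A (A x)" for x
    by (simp add: bounded_clinear_scale[OF bounded_clinear_cadjoint[OF A]] scaleC_scaleC
        complex_norm_square mult.commute del: of_real_power)
  have "finite {k. cmod c * s k = r} \<and> card {k. cmod c * s k = r} =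
      cdim {x. cadjoint (\<lambda>x. c *\<^sub>C A x) (c *\<^sub>C A x) = complex_of_real (r\<^sup>2) *\<^sub>C x}" if r: "0 < r" for r
  proof (cases "c = 0")
    case True
    \<comment> \<open>For \<open>c = 0\<close> the sequence is constantly 0 and the eigenspace of a
      positive value is trivial, so both counts vanish.\<close>
    then have "{k. cmod c * s k = r} = {}"
      "{x. cadjoint (\<lambda>x. c *\<^sub>C A x) (c *\<^sub>C A x) = complex_of_real (r\<^sup>2) *\<^sub>C x} = {0 :: 'a}"
      unfolding B using r by auto
    then show ?thesis using complex_vector.dim_span_eq_card_independent[of "{}"] complex_vector.dim_span[of "{}"]
      by (simp add: complex_vector.independent_empty complex_vector.span_empty)
  next
    case False
    have "cmod c * s k = r \<longleftrightarrow> s k = r / cmod c" for k using False by (auto simp: field_simps)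
    moreover have "(complex_of_real ((cmod c)\<^sup>2) *\<^sub>C cadjoint A (A x) = complex_of_real (r\<^sup>2) *\<^sub>C x) \<longleftrightarrow>
        (cadjoint A (A x) = complex_of_real ((r / cmod c)\<^sup>2) *\<^sub>C x)" (is "?L \<longleftrightarrow> ?R") for x
    proof -
      have eq: "complex_of_real (r\<^sup>2) *\<^sub>C x = complex_of_real ((cmod c)\<^sup>2) *\<^sub>C (complex_of_real ((r / cmod c)\<^sup>2) *\<^sub>C x)"
        using False by (simp add: scaleC_scaleC power_divide)
      show ?thesis unfolding eq complex_vector.scale_cancel_left using False by simp
    qed
    moreover have "0 < r / cmod c" using r False by simp
    ultimately show ?thesis using s unfolding singular_value_seq_def B by simp
  qed
  moreover have "decseq (\<lambda>k. cmod c * s k)"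
    using s by (auto simp: singular_value_seq_def decseq_def intro: mult_left_mono)
  ultimately show ?thesis
    using s unfolding singular_value_seq_def by simp
qed

text \<open>With \<open>Q\<close> the complementary projection, the adjoint of \<open>A Q\<close> is
  \<open>Q\<close> after \<open>cadjoint A\<close>. For positive \<open>r\<close> its singular space
  therefore consists of the vectors in that of \<open>A\<close> which are orthogonal to the first
  \<open>n\<close> singular vectors: removing these shifts the sequence by \<open>n\<close>.\<close>

lemma singular_value_seq_truncate:
  fixes n :: nat
  assumes A: "compact_operator A" and s: "singular_value_seq A s" and \<phi>: "singular_family A s \<phi>"
  defines "P \<equiv> ortho_proj \<phi> {k. k < n \<and> 0 < s k}"
  shows "compact_operator (\<lambda>x. A (x - P x))" "singular_value_seq (\<lambda>x. A (x - P x)) (\<lambda>k. s (k + n))"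
proof -
  have A': "bounded_clinear A" using A by (simp add: compact_operator_def)
  define K where "K = {k. k < n \<and> 0 < s k}"
  have K: "finite K" "orthonormal_on \<phi> K"
    using \<phi> orthonormal_on_subset[of \<phi> "{k. 0 < s k}" K] by (auto simp: K_def singular_family_def)
  have P: "P = ortho_proj \<phi> K" by (simp add: P_def K_def)
  define Q where "Q x = x - P x" for x
  have Q': "bounded_clinear Q"
    unfolding Q_def P by (intro bounded_clinear_minus bounded_clinear_id bounded_clinear_ortho_proj)
  have Q_sym: "cinner (Q x) y = cinner x (Q y)" for x y
    unfolding Q_def P cinner_diff_left cinner_diff_right cinner_ortho_proj_commute ..
  have Q_orth: "cinner (Q x) (\<phi> k) = 0" if "k \<in> K" for k x
    unfolding Q_def P by (rule ortho_proj_orthogonal[OF K(2,1) that])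
  have Q_id: "Q x = x" if "\<And>k. k \<in> K \<Longrightarrow> cinner x (\<phi> k) = 0" for x
    using that by (simp add: Q_def P ortho_proj_def)
  have AQ: "(\<lambda>x. A (x - P x)) = (\<lambda>x. A (Q x))" by (simp add: Q_def)
  show "compact_operator (\<lambda>x. A (x - P x))"
    unfolding AQ by (rule compact_operator_contraction[OF A Q'])
      (use norm_diff_ortho_proj_le[OF K(2,1)] in \<open>simp add: Q_def P\<close>)
  have B': "bounded_clinear (\<lambda>x. A (Q x))" using A' Q' by (rule bounded_clinear_comp)
  have adj: "cadjoint (\<lambda>x. A (Q x)) = (\<lambda>y. Q (cadjoint A y))"
    by (rule cadjoint_eqI[OF B']) (simp add: cinner_cadjoint[OF A'] Q_sym)
  have eig: "cadjoint A (A (\<phi> k)) = complex_of_real ((s k)\<^sup>2) *\<^sub>C \<phi> k" if "0 < s k" for k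
    using singular_family_mem[OF \<phi> that] by (simp add: singular_space_def)
  have eigenspace: "singular_space (\<lambda>x. A (Q x)) r = cspan (\<phi> ` {k. s k = r \<and> n \<le> k})" if r: "0 < r" for r
  proof
    show "cspan (\<phi> ` {k. s k = r \<and> n \<le> k}) \<subseteq> singular_space (\<lambda>x. A (Q x)) r"
    proof (rule complex_vector.span_minimal[OF _ singular_space_subspace[OF B']], safe)
      fix k
      assume k: "r = s k" "n \<le> k"
      have "cinner (\<phi> k) (\<phi> j) = 0" if "j \<in> K" for j
        using \<phi> that k r by (auto simp: singular_family_def K_def orthonormal_on_def)
      then have "Q (\<phi> k) = \<phi> k" by (rule Q_id)
      then show "\<phi> k \<in> singular_space (\<lambda>x. A (Q x)) (s k)"
        using eig[of k] k r by (simp add: singular_space_def adj bounded_clinear_scale[OF Q'])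
    qed
  next
    show "singular_space (\<lambda>x. A (Q x)) r \<subseteq> cspan (\<phi> ` {k. s k = r \<and> n \<le> k})"
    proof
      fix x
      assume "x \<in> singular_space (\<lambda>x. A (Q x)) r"
      then have x: "Q (cadjoint A (A (Q x))) = complex_of_real (r\<^sup>2) *\<^sub>C x"
        by (simp add: singular_space_def adj)
      \<comment> \<open>As \<open>r\<close> is nonzero, the eigenvalue equation puts
        \<open>x\<close> into the range of \<open>Q\<close>.\<close>
      have xK: "cinner x (\<phi> k) = 0" if "k \<in> K" for k
        using Q_orth[OF that, of "cadjoint A (A (Q x))"] r by (simp add: x cinner_scaleC_left)
      then have Qx: "Q x = x" by (rule Q_id)
      have "cinner (cadjoint A (A x)) (\<phi> k) = 0" if "k \<in> K" for k
        using xK[OF that] eig[of k] that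
        by (simp add: cinner_cadjoint'[OF A'] cinner_cadjoint[OF A'] cinner_scaleC_right K_def)
      then have "Q (cadjoint A (A x)) = cadjoint A (A x)" by (rule Q_id)
      with x Qx have "x \<in> singular_space A r" by (simp add: singular_space_def)
      then have "x \<in> cspan (\<phi> ` {k. s k = r})" using \<phi> r by (simp add: singular_family_def)
      moreover have "orthonormal_on \<phi> {k. s k = r}" "finite {k. s k = r}"
        using \<phi> s r orthonormal_on_subset[of \<phi> "{k. 0 < s k}" "{k. s k = r}"]
        by (auto simp: singular_family_def singular_value_seq_def)
      ultimately have "x = ortho_proj \<phi> {k. s k = r} x" by (simp add: ortho_proj_span)
      also have "\<dots> = ortho_proj \<phi> {k. s k = r \<and> n \<le> k} x"
        unfolding ortho_proj_def
        using \<open>finite {k. s k = r}\<close> xK r by (intro sum.mono_neutral_right) (auto simp: K_def not_le)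
      also have "\<dots> \<in> cspan (\<phi> ` {k. s k = r \<and> n \<le> k})" by (rule ortho_proj_in_span)
      finally show "x \<in> cspan (\<phi> ` {k. s k = r \<and> n \<le> k})" .
    qed
  qed
  have "finite {k. s (k + n) = r} \<and> card {k. s (k + n) = r} = cdim (singular_space (\<lambda>x. A (Q x)) r)"
    if r: "0 < r" for r
  proof -
    have bij: "bij_betw (\<lambda>k. k + n) {k. s (k + n) = r} {k. s k = r \<and> n \<le> k}"
      by (rule bij_betw_byWitness[where f' = "\<lambda>k. k - n"]) auto
    have "finite {k. s k = r \<and> n \<le> k}" using s r by (simp add: singular_value_seq_def)
    moreover have "orthonormal_on \<phi> {k. s k = r \<and> n \<le> k}"
      using \<phi> r orthonormal_on_subset[of \<phi> "{k. 0 < s k}" "{k. s k = r \<and> n \<le> k}"]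
      by (auto simp: singular_family_def)
    ultimately show ?thesis
      using bij_betw_finite[OF bij] bij_betw_same_card[OF bij] orthonormal_on_dim[of \<phi>]
      by (simp add: eigenspace[OF r])
  qed
  moreover have "decseq (\<lambda>k. s (k + n))"
    using s by (auto simp: singular_value_seq_def decseq_def)
  ultimately show "singular_value_seq (\<lambda>x. A (x - P x)) (\<lambda>k. s (k + n))"
    unfolding AQ using s unfolding singular_value_seq_def singular_space_def by simp
qed

text \<open>Cutting \<open>z A\<close> off after \<open>n\<close> singular vectors leaves an error
  whose singular values are \<open>cmod z * s (k + n)\<close>, so its trace norm is the tail of a
  convergent series. These operators give the uniqueness of the limit in
  \<open>Det_I_plus\<close>.\<close>

lemma finite_rank_approximation:
  assumes A: "trace_class A" and \<delta>: "0 < \<delta>"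
  obtains F where "finite_rank F" "trace_class (\<lambda>x. F x - z *\<^sub>C A x)"
    "trace_norm (\<lambda>x. F x - z *\<^sub>C A x) < \<delta>"
proof -
  define s where "s = singular_values A"
  have A': "bounded_clinear A" and s: "compact_operator A" "singular_value_seq A s" "summable s"
    using trace_class_singular_values[OF A] by (auto simp: s_def)
  obtain \<phi> where \<phi>: "singular_family A s \<phi>" using singular_family_exists[OF s(1,2)] .
  have tail: "(\<Sum>k. cmod z * s (k + n)) = cmod z * (suminf s - (\<Sum>k<n. s k))" for n
    using s(3) summable_ignore_initial_segment[OF s(3), of n]
    by (simp add: suminf_mult suminf_minus_initial_segment)
  have "(\<lambda>n. cmod z * (suminf s - (\<Sum>k<n. s k))) \<longlonglongrightarrow> cmod z * (suminf s - suminf s)"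
    by (intro tendsto_intros summable_LIMSEQ s)
  then have "\<forall>\<^sub>F n in sequentially. cmod z * (suminf s - (\<Sum>k<n. s k)) < \<delta>"
    using \<delta> by (intro order_tendstoD) auto
  then obtain n where n: "(\<Sum>k. cmod z * s (k + n)) < \<delta>"
    unfolding tail using eventually_happens'[OF sequentially_bot] by blast
  define P where "P = ortho_proj \<phi> {k. k < n \<and> 0 < s k}"
  define F where "F x = z *\<^sub>C A (P x)" for x
  note trunc = singular_value_seq_truncate[OF s(1,2) \<phi>, of n, folded P_def]
  have eq: "(\<lambda>x. F x - z *\<^sub>C A x) = (\<lambda>x. (- z) *\<^sub>C A (x - P x))"
    by (simp add: F_def bounded_clinear_diff[OF A'] complex_vector.scale_right_diff_distrib)
  have svs: "singular_value_seq (\<lambda>x. F x - z *\<^sub>C A x) (\<lambda>k. cmod z * s (k + n))"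
    unfolding eq using singular_value_seq_scaleC[OF _ trunc(2), of "- z"] trunc(1)
    by (simp add: compact_operator_def)
  have cmp: "compact_operator (\<lambda>x. F x - z *\<^sub>C A x)"
    unfolding eq by (rule compact_operator_scaleC[OF trunc(1)])
  have sm: "summable (\<lambda>k. cmod z * s (k + n))"
    by (intro summable_mult summable_ignore_initial_segment s)
  have "finite_rank F"
    unfolding finite_rank_def
  proof (intro conjI exI)
    show "bounded_clinear F"
      unfolding F_def P_def
      by (intro bounded_clinear_scaleC bounded_clinear_comp[OF A'] bounded_clinear_ortho_proj)
    show "finite ((\<lambda>k. A (\<phi> k)) ` {k. k < n \<and> 0 < s k})" by simp
    show "range F \<subseteq> cspan ((\<lambda>k. A (\<phi> k)) ` {k. k < n \<and> 0 < s k})"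
      unfolding F_def P_def ortho_proj_def bounded_clinear_sum[OF A'] bounded_clinear_scale[OF A']
      by (intro image_subsetI complex_vector.span_scale complex_vector.span_sum)
        (rule complex_vector.span_base, blast)
  qed
  with that trace_classI[OF cmp svs sm] n show ?thesis by simp
qed

section \<open>Triangular form of operators of finite rank\<close>

definition op_poly :: "('h::complex_hilbert \<Rightarrow> 'h) \<Rightarrow> complex poly \<Rightarrow> 'h \<Rightarrow> 'h" where
  "op_poly F p x = (\<Sum>i\<le>degree p. Polynomial.coeff p i *\<^sub>C (F ^^ i) x)"

text \<open>Pads the sum with zero coefficients, so that polynomials of different degrees share one
  index range.\<close>

lemma op_poly_eq_sum:
  assumes "degree p \<le> n"
  shows "op_poly F p x = (\<Sum>i\<le>n. Polynomial.coeff p i *\<^sub>C (F ^^ i) x)"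
  unfolding op_poly_def using assms
  by (intro sum.mono_neutral_left) (auto simp: coeff_eq_0)

lemma op_poly_diff: "op_poly F (p - q) x = op_poly F p x - op_poly F q x"
proof -
  define n where "n = max (degree p) (degree q)"
  have "degree (p - q) \<le> n" "degree p \<le> n" "degree q \<le> n"
    using degree_diff_le_max[of p q] by (auto simp: n_def)
  then show ?thesis
    by (simp add: op_poly_eq_sum[of _ n] complex_vector.scale_left_diff_distrib sum_subtractf)
qed

lemma op_poly_smult: "op_poly F (Polynomial.smult a p) x = a *\<^sub>C op_poly F p x"
  using degree_smult_le[of a p]
  by (simp add: op_poly_eq_sum[of _ "degree p"] complex_vector.scale_sum_right scaleC_scaleC)

lemma op_poly_pCons_0:
  assumes "bounded_clinear F"
  shows "op_poly F (pCons 0 p) x = F (op_poly F p x)"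
proof -
  have "degree (pCons 0 p) \<le> Suc (degree p)" by (rule degree_pCons_le)
  then show ?thesis
    by (simp add: op_poly_eq_sum[of _ "Suc (degree p)"] op_poly_def sum.atMost_Suc_shift
        bounded_clinear_sum[OF assms] bounded_clinear_scale[OF assms] del: sum.atMost_Suc)
qed

lemma op_poly_linear_factor:
  assumes "bounded_clinear F"
  shows "op_poly F ([:-a, 1:] * q) x = F (op_poly F q x) - a *\<^sub>C op_poly F q x"
proof -
  have "[:-a, 1:] * q = pCons 0 q - Polynomial.smult a q" by simp
  then show ?thesis by (simp only: op_poly_diff op_poly_smult op_poly_pCons_0[OF assms])
qed

text \<open>The first \<open>card B + 1\<close> vectors of the orbit lie in a span of
  \<open>card B\<close> vectors; a linear relation among them is the polynomial.\<close>

lemma op_poly_annihilator: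
  assumes "finite B" and orbit: "\<And>i. (F ^^ i) x \<in> cspan B"
  obtains p where "p \<noteq> 0" "op_poly F p x = 0"
proof -
  define N where "N = card B"
  let ?f = "\<lambda>i. (F ^^ i) x"
  have "\<exists>c. (\<exists>i\<le>N. c i \<noteq> 0) \<and> (\<Sum>i\<le>N. c i *\<^sub>C ?f i) = 0"
  proof (cases "inj_on ?f {..N}")
    case True
    have "complex_vector.dependent (?f ` {..N})"
    proof (rule ccontr)
      assume "\<not> complex_vector.dependent (?f ` {..N})"
      then have "card (?f ` {..N}) \<le> card B"
        using complex_vector.independent_span_bound[OF assms(1)] orbit by blast
      then show False using card_image[OF True] by (simp add: N_def)
    qed
    then obtain u where u: "\<exists>v\<in>?f ` {..N}. u v \<noteq> 0" "(\<Sum>v\<in>?f ` {..N}. u v *\<^sub>C v) = 0"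
      using complex_vector.dependent_finite[of "?f ` {..N}"] by auto
    have "(\<Sum>i\<le>N. u (?f i) *\<^sub>C ?f i) = 0"
      using u(2) by (simp add: sum.reindex[OF True])
    then show ?thesis using u(1) by (intro exI[of _ "\<lambda>i. u (?f i)"]) auto
  next
    \<comment> \<open>\<open>dependent\<close> speaks of sets and does not see a repetition in the
      orbit. A repetition is itself a relation, with coefficients 1 and -1.\<close>
    case False
    then obtain i j where ij: "i \<le> N" "j \<le> N" "i \<noteq> j" "?f i = ?f j"
      by (auto simp: inj_on_def)
    define c :: "nat \<Rightarrow> complex" where "c k = (if k = i then 1 else 0) - (if k = j then 1 else 0)" for k
    have "(\<Sum>k\<le>N. c k *\<^sub>C ?f k) =
        (\<Sum>k\<le>N. (if k = i then ?f k else 0)) - (\<Sum>k\<le>N. (if k = j then ?f k else 0))"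
      unfolding sum_subtractf[symmetric] c_def complex_vector.scale_left_diff_distrib
      by (intro sum.cong) (auto simp: scaleC_one)
    also have "\<dots> = 0" using ij by simp
    finally show ?thesis using ij by (intro exI[of _ c]) (auto simp: c_def)
  qed
  then obtain c k where c: "k \<le> N" "c k \<noteq> 0" "(\<Sum>i\<le>N. c i *\<^sub>C ?f i) = 0" by blast
  define p where "p = (\<Sum>i\<le>N. Polynomial.monom (c i) i)"
  have coeff_p: "Polynomial.coeff p i = (if i \<le> N then c i else 0)" for i
    by (simp add: p_def Polynomial.coeff_sum)
  have "degree p \<le> N" by (rule degree_le) (simp add: coeff_p)
  then have "op_poly F p x = 0"
    using c(3) by (simp add: op_poly_eq_sum[of p N] coeff_p)
  moreover have "p \<noteq> 0" using c coeff_p[of k] by auto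
  ultimately show ?thesis using that by blast
qed

text \<open>Linear factors are split off one at a time. If \<open>p\<close> is \<open>X - a\<close>
  times \<open>q\<close>, either \<open>q\<close> already sends \<open>w\<close> into
  \<open>U\<close> and has smaller degree, or its value at \<open>w\<close> is an eigenvector for
  \<open>a\<close> modulo \<open>U\<close>. A nonzero constant cannot be reached, as it would put
  \<open>w\<close> in \<open>U\<close>.\<close>

lemma eigenvector_mod_subspace:
  assumes F: "bounded_clinear F" and U: "complex_vector.subspace U" and V: "complex_vector.subspace V"
    and FV: "\<And>x. x \<in> V \<Longrightarrow> F x \<in> V"
    and w: "w \<in> V" "w \<notin> U" and p: "p \<noteq> 0" "op_poly F p w \<in> U"
  shows "\<exists>u a. u \<in> V \<and> u \<notin> U \<and> F u - a *\<^sub>C u \<in> U"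
  using p
proof (induction "degree p" arbitrary: p rule: less_induct)
  case less
  have orbit: "(F ^^ i) w \<in> V" for i
    by (induction i) (auto simp: w FV)
  show ?case
  proof (cases "degree p = 0")
    case True
    then obtain c where c: "p = [:c:]" "c \<noteq> 0" using less.prems(1) by (metis degree_eq_zeroE pCons_0_0)
    then have "c *\<^sub>C w \<in> U" using less.prems(2) by (simp add: op_poly_def)
    then have "(1 / c) *\<^sub>C (c *\<^sub>C w) \<in> U" by (rule complex_vector.subspace_scale[OF U])
    then have "w \<in> U" using c by (simp add: scaleC_scaleC scaleC_one)
    then show ?thesis using w by simp
  next
    case False
    then obtain a where "poly p a = 0"
      using fundamental_theorem_of_algebra[of p] by (auto simp: constant_degree)
    then obtain q where q: "p = [:-a, 1:] * q" by (auto simp: poly_eq_0_iff_dvd dvd_def)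
    then have q0: "q \<noteq> 0" using less.prems(1) by auto
    then have deg: "degree q < degree p" unfolding q by (subst degree_mult_eq) auto
    show ?thesis
    proof (cases "op_poly F q w \<in> U")
      case True
      then show ?thesis using less.hyps[OF deg q0] by blast
    next
      case False
      have "op_poly F q w \<in> V"
        unfolding op_poly_def
        by (intro complex_vector.subspace_sum[OF V] complex_vector.subspace_scale[OF V] orbit)
      then show ?thesis
        using False less.prems(2) op_poly_linear_factor[OF F, of a q w] unfolding q by metis
    qed
  qed
qed

text \<open>The matrix of \<open>F\<close> in the basis \<open>v\<close> of its span is upper
  triangular with diagonal \<open>\<mu>\<close>.\<close>

definition triangular_basis ::
  "('h::complex_hilbert \<Rightarrow> 'h) \<Rightarrow> (nat \<Rightarrow> 'h) \<Rightarrow> (nat \<Rightarrow> complex) \<Rightarrow> nat \<Rightarrow> bool" where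
  "triangular_basis F v \<mu> n \<longleftrightarrow> orthonormal_on v {..<n} \<and>
     (\<forall>k<n. F (v k) - \<mu> k *\<^sub>C v k \<in> cspan (v ` {..<k}))"

abbreviation flag :: "(nat \<Rightarrow> 'h::complex_hilbert) \<Rightarrow> nat \<Rightarrow> 'h set" where
  "flag v k \<equiv> cspan (v ` {..<k})"

lemma flag_subspace: "complex_vector.subspace (flag v k)"
  by (rule complex_vector.subspace_span)

lemma flag_mono: "j \<le> k \<Longrightarrow> flag v j \<subseteq> flag v k"
  by (intro complex_vector.span_mono) auto

lemma flag_base: "i < k \<Longrightarrow> v i \<in> flag v k"
  by (intro complex_vector.span_base) auto

lemma flag_Suc: "x \<in> flag v (Suc k) \<longleftrightarrow> (\<exists>c. x - c *\<^sub>C v k \<in> flag v k)"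
  by (simp add: lessThan_Suc complex_vector.span_breakdown_eq)

lemma flag_not_mem:
  assumes "orthonormal_on v {..<n}" "k < n"
  shows "c *\<^sub>C v k \<in> flag v k \<longleftrightarrow> c = 0"
proof
  assume c: "c *\<^sub>C v k \<in> flag v k"
  have "cinner (v k) (c *\<^sub>C v k) = 0"
    by (rule cspan_cinner_zero[OF _ c]) (use assms in \<open>auto simp: orthonormal_on_def\<close>)
  then show "c = 0" using assms by (simp add: cinner_scaleC_right orthonormal_on_def)
qed (simp add: complex_vector.span_zero)

lemma triangular_basis_invariant:
  assumes F: "bounded_clinear F" and tri: "triangular_basis F v \<mu> n" and "k \<le> n" and x: "x \<in> flag v k"
  shows "F x \<in> flag v k"
  using x
proof (induction rule: complex_vector.span_induct_alt)
  case base
  show ?case by (simp add: bounded_clinear_0[OF F] complex_vector.span_zero)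
next
  case (step c u y)
  then obtain i where i: "i < k" "u = v i" by auto
  have "F (v i) - \<mu> i *\<^sub>C v i \<in> flag v k"
    using tri i assms(3) flag_mono[of i k v] by (auto simp: triangular_basis_def)
  then have "(F (v i) - \<mu> i *\<^sub>C v i) + \<mu> i *\<^sub>C v i \<in> flag v k"
    using i by (intro complex_vector.span_add complex_vector.span_scale flag_base)
  then show ?case
    using step.IH i by (simp add: bounded_clinear_add[OF F] bounded_clinear_scale[OF F]
        complex_vector.span_add complex_vector.span_scale)
qed

text \<open>The new vector starts as an eigenvector \<open>y\<close> modulo the flag.
  Orthonormalising it subtracts only an element of the flag, which \<open>F\<close> leaves
  invariant, so it stays an eigenvector modulo the flag for the same \<open>a\<close>.\<close>

lemma triangular_basis_extend:
  assumes F: "bounded_clinear F" and B: "finite B" "range F \<subseteq> cspan B"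
    and tri: "triangular_basis F v \<mu> n" "v ` {..<n} \<subseteq> cspan B" and ne: "\<not> cspan B \<subseteq> flag v n"
  shows "\<exists>v \<mu>. triangular_basis F v \<mu> (Suc n) \<and> v ` {..<Suc n} \<subseteq> cspan B"
proof -
  have on: "orthonormal_on v {..<n}" using tri(1) by (simp add: triangular_basis_def)
  obtain w where w: "w \<in> cspan B" "w \<notin> flag v n" using ne by blast
  have "(F ^^ i) w \<in> cspan B" for i using w(1) B(2) by (cases i) auto
  then obtain p where p: "p \<noteq> 0" "op_poly F p w = 0" using op_poly_annihilator[OF B(1)] by metis
  then have p': "op_poly F p w \<in> flag v n" by (simp add: complex_vector.span_zero)
  obtain y a where y: "y \<in> cspan B" "y \<notin> flag v n" "F y - a *\<^sub>C y \<in> flag v n"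
    using eigenvector_mod_subspace[OF F flag_subspace complex_vector.subspace_span _ w p(1) p'] B(2)
    by blast
  obtain c u where u: "norm u = 1" "\<And>i. i \<in> {..<n} \<Longrightarrow> cinner u (v i) = 0"
    "u = c *\<^sub>C (y - ortho_proj v {..<n} y)"
    using gram_schmidt_step[OF on _ y(2)] by (metis finite_lessThan)
  let ?q = "ortho_proj v {..<n} y"
  have q: "?q \<in> flag v n" by (rule ortho_proj_in_span)
  have Fq: "F ?q \<in> flag v n" by (rule triangular_basis_invariant[OF F tri(1) order_refl q])
  have "F u - a *\<^sub>C u = c *\<^sub>C ((F y - a *\<^sub>C y) - (F ?q - a *\<^sub>C ?q))"
    unfolding u(3) by (simp add: bounded_clinear_scale[OF F] bounded_clinear_diff[OF F]
        complex_vector.scale_right_diff_distrib scaleC_scaleC mult.commute algebra_simps)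
  also have "\<dots> \<in> flag v n"
    by (rule complex_vector.span_scale[OF complex_vector.span_diff[OF y(3)
          complex_vector.span_diff[OF Fq complex_vector.span_scale[OF q]]]])
  finally have Fu: "F u - a *\<^sub>C u \<in> flag v n" .
  have uB: "u \<in> cspan B"
    unfolding u(3) using y(1) q complex_vector.span_minimal[OF tri(2) complex_vector.subspace_span]
    by (intro complex_vector.span_scale complex_vector.span_diff) auto
  let ?v = "v(n := u)" and ?\<mu> = "\<mu>(n := a)"
  have flag_eq: "flag ?v k = flag v k" if "k \<le> n" for k
    using that by (intro arg_cong[where f = cspan] image_cong) auto
  have "orthonormal_on ?v (insert n {..<n})"
  proof (rule orthonormal_on_insert)
    show "orthonormal_on ?v {..<n}" using on by (simp add: orthonormal_on_def)
  qed (use u in auto)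
  moreover have "F (?v k) - ?\<mu> k *\<^sub>C ?v k \<in> flag ?v k" if k: "k < Suc n" for k
  proof (cases "k = n")
    case True
    then show ?thesis unfolding flag_eq[OF less_Suc_eq_le[THEN iffD1, OF k]] using Fu by simp
  next
    case False
    then show ?thesis
      unfolding flag_eq[OF less_Suc_eq_le[THEN iffD1, OF k]]
      using k tri(1) by (simp add: triangular_basis_def)
  qed
  ultimately have "triangular_basis F ?v ?\<mu> (Suc n)"
    unfolding triangular_basis_def lessThan_Suc by blast
  moreover have "?v ` {..<Suc n} \<subseteq> cspan B" using tri(2) uB by (auto simp: less_Suc_eq)
  ultimately show ?thesis by blast
qed

text \<open>A longest triangular system inside \<open>cspan B\<close> exists because its length is
  at most \<open>card B\<close>, and it spans \<open>cspan B\<close> because otherwise it could be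
  extended.\<close>

lemma triangular_basis_exists:
  assumes F: "finite_rank F"
  obtains v \<mu> n where "triangular_basis F v \<mu> n" "range F \<subseteq> flag v n"
proof -
  obtain B where F': "bounded_clinear F" and B: "finite B" "range F \<subseteq> cspan B"
    using F by (auto simp: finite_rank_def)
  define P where "P n \<longleftrightarrow> (\<exists>v \<mu>. triangular_basis F v \<mu> n \<and> v ` {..<n} \<subseteq> cspan B)" for n
  have le: "n \<le> card B" if Pn: "P n" for n
  proof -
    obtain v \<mu> where "triangular_basis F v \<mu> n" and sub: "v ` {..<n} \<subseteq> cspan B"
      using Pn P_def by blast
    then have on: "orthonormal_on v {..<n}" by (simp add: triangular_basis_def)
    have "n = cdim (flag v n)" using orthonormal_on_dim[OF on] by simp
    also have "\<dots> \<le> card B"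
      using sub B(1) complex_vector.span_minimal[OF sub complex_vector.subspace_span]
      by (intro complex_vector.dim_le_card)
    finally show ?thesis .
  qed
  have "P 0" by (simp add: P_def triangular_basis_def orthonormal_on_def)
  then obtain n where n: "P n" "\<And>m. P m \<Longrightarrow> m \<le> n"
    using ex_has_greatest_nat[of P 0 "\<lambda>n. n" "Suc (card B)"] le by (metis less_Suc_eq_le)
  then obtain v \<mu> where v: "triangular_basis F v \<mu> n" "v ` {..<n} \<subseteq> cspan B"
    using P_def by blast
  have "cspan B \<subseteq> flag v n"
  proof (rule ccontr)
    assume "\<not> cspan B \<subseteq> flag v n"
    then have "P (Suc n)" using triangular_basis_extend[OF F' B v] by (simp add: P_def)
    then show False using n(2)[of "Suc n"] by simp
  qed
  with B(2) v(1) that show ?thesis by blast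
qed

text \<open>Passing from one flag space to the next adds at most one dimension to the intersection
  with \<open>G\<close>, and it adds one exactly when \<open>G\<close> has a vector new at that
  step. Thus dimensions are counted by jumps.\<close>

lemma dim_flag_intersection:
  assumes G: "complex_vector.subspace G"
  shows "\<exists>B. finite B \<and> \<not> complex_vector.dependent B \<and> cspan B = G \<inter> flag v n \<and>
    card B = card {k. k < n \<and> (\<exists>x\<in>G. x \<in> flag v (Suc k) \<and> x \<notin> flag v k)}"
proof (induction n)
  case 0
  have "G \<inter> {0} = {0}" using complex_vector.subspace_0[OF G] by blast
  then show ?case by (intro exI[of _ "{}"]) (auto simp: complex_vector.independent_empty)
next
  case (Suc n)
  let ?I = "\<lambda>n. {k. k < n \<and> (\<exists>x\<in>G. x \<in> flag v (Suc k) \<and> x \<notin> flag v k)}"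
  have finI: "finite (?I n)" by simp
  obtain B where B: "finite B" "\<not> complex_vector.dependent B" "cspan B = G \<inter> flag v n"
    "card B = card (?I n)" using Suc.IH by blast
  show ?case
  proof (cases "\<exists>x\<in>G. x \<in> flag v (Suc n) \<and> x \<notin> flag v n")
    case False
    then have "?I (Suc n) = ?I n" by (auto simp: less_Suc_eq)
    moreover have "G \<inter> flag v (Suc n) = G \<inter> flag v n"
      using False flag_mono[of n "Suc n" v] by auto
    ultimately show ?thesis using B by metis
  next
    case True
    then obtain x where x: "x \<in> G" "x \<in> flag v (Suc n)" "x \<notin> flag v n" by blast
    obtain d where d: "x - d *\<^sub>C v n \<in> flag v n" using x(2) flag_Suc by blast
    then have d0: "d \<noteq> 0" using x(3) by auto
    have xB: "x \<notin> cspan B" using x(3) B(3) by blast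
    have "cspan (insert x B) = G \<inter> flag v (Suc n)"
    proof
      have "insert x B \<subseteq> G \<inter> flag v (Suc n)"
        using x B(3) complex_vector.span_superset[of B] flag_mono[of n "Suc n" v] by auto
      then show "cspan (insert x B) \<subseteq> G \<inter> flag v (Suc n)"
        by (rule complex_vector.span_minimal)
          (intro complex_vector.subspace_inter G flag_subspace)
    next
      show "G \<inter> flag v (Suc n) \<subseteq> cspan (insert x B)"
      proof
        fix z
        assume z: "z \<in> G \<inter> flag v (Suc n)"
        then obtain c where c: "z - c *\<^sub>C v n \<in> flag v n" using flag_Suc by blast
        \<comment> \<open>The multiple of \<open>x\<close> is chosen to cancel the
          \<open>v n\<close> component of \<open>z\<close>.\<close>
        have "z - (c / d) *\<^sub>C x = (z - c *\<^sub>C v n) - (c / d) *\<^sub>C (x - d *\<^sub>C v n)"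
          using d0 by (simp add: complex_vector.scale_right_diff_distrib scaleC_scaleC)
        also have "\<dots> \<in> flag v n"
          by (rule complex_vector.span_diff[OF c complex_vector.span_scale[OF d]])
        finally have "z - (c / d) *\<^sub>C x \<in> cspan B"
          using z x(1) B(3) G by (simp add: complex_vector.subspace_diff complex_vector.subspace_scale)
        then show "z \<in> cspan (insert x B)" unfolding complex_vector.span_breakdown_eq by blast
      qed
    qed
    moreover have "\<not> complex_vector.dependent (insert x B)"
      using B(2) xB by (rule complex_vector.independent_insertI[rotated])
    moreover have "card (insert x B) = card (?I (Suc n))"
    proof -
      have "?I (Suc n) = insert n (?I n)" using True by (auto simp: less_Suc_eq)
      moreover have "x \<notin> B" using xB complex_vector.span_base by blast
      ultimately show ?thesis using B(1,4) finI by simp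
    qed
    ultimately show ?thesis using B(1) by blast
  qed
qed

section \<open>Products of the commuting operators \<open>F - a\<close>\<close>

abbreviation shift_op :: "('h::complex_hilbert \<Rightarrow> 'h) \<Rightarrow> complex \<Rightarrow> 'h \<Rightarrow> 'h" where
  "shift_op F a \<equiv> (\<lambda>y. F y - a *\<^sub>C y)"

lemma bounded_clinear_shift_op: "bounded_clinear F \<Longrightarrow> bounded_clinear (shift_op F a)"
  by (intro bounded_clinear_minus bounded_clinear_scaleC bounded_clinear_id)

lemma shift_op_commute:
  assumes "bounded_clinear F"
  shows "shift_op F a (shift_op F b x) = shift_op F b (shift_op F a x)"
  by (simp add: bounded_clinear_diff[OF assms] bounded_clinear_scale[OF assms]
      complex_vector.scale_right_diff_distrib scaleC_scaleC mult.commute algebra_simps)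

lemma shift_op_funpow_commute:
  assumes "bounded_clinear F"
  shows "shift_op F a ((shift_op F b ^^ k) x) = (shift_op F b ^^ k) (shift_op F a x)"
proof (induction k)
  case (Suc k)
  have "shift_op F a ((shift_op F b ^^ Suc k) x) = shift_op F b (shift_op F a ((shift_op F b ^^ k) x))"
    using shift_op_commute[OF assms, where a = a and b = b and x = "(shift_op F b ^^ k) x"] by simp
  then show ?case by (simp add: Suc.IH)
qed simp

text \<open>Commutation moves all factors for \<open>a\<close> to the outside. When the full product
  vanishes, the product of the other factors is thereby seen to yield a generalized eigenvector for
  \<open>a\<close>.\<close>

lemma foldr_shift_op_filter:
  assumes "bounded_clinear F"
  shows "foldr (shift_op F) as x =
    (shift_op F a ^^ length (filter (\<lambda>b. b = a) as)) (foldr (shift_op F) (filter (\<lambda>b. b \<noteq> a) as) x)"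
proof (induction as)
  case (Cons c as)
  then show ?case
    using shift_op_funpow_commute[OF assms, where a = c and b = a] by (cases "c = a") simp_all
qed simp

text \<open>Modulo the invariant flag below \<open>v k\<close>, the operator acts on
  \<open>v k\<close> as the scalar \<open>\<mu> k\<close>, so every factor multiplies the
  coefficient by \<open>\<mu> k - a\<close>.\<close>

lemma foldr_shift_op_diagonal:
  assumes F: "bounded_clinear F" and tri: "triangular_basis F v \<mu> n" and k: "k < n"
    and x: "x - c *\<^sub>C v k \<in> flag v k"
  shows "foldr (shift_op F) as x - (c * (\<Prod>a\<leftarrow>as. \<mu> k - a)) *\<^sub>C v k \<in> flag v k"
proof (induction as)
  case Nil
  then show ?case using x by simp
next
  case (Cons a as)
  define d where "d = c * (\<Prod>a\<leftarrow>as. \<mu> k - a)"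
  define y where "y = foldr (shift_op F) as x"
  have y: "y - d *\<^sub>C v k \<in> flag v k" using Cons by (simp add: d_def y_def)
  have "F (v k) - \<mu> k *\<^sub>C v k \<in> flag v k" using tri k by (simp add: triangular_basis_def)
  moreover have "F (y - d *\<^sub>C v k) \<in> flag v k"
    using triangular_basis_invariant[OF F tri _ y] k by simp
  moreover have "shift_op F a y - (d * (\<mu> k - a)) *\<^sub>C v k =
      F (y - d *\<^sub>C v k) - a *\<^sub>C (y - d *\<^sub>C v k) + d *\<^sub>C (F (v k) - \<mu> k *\<^sub>C v k)"
    by (simp add: bounded_clinear_diff[OF F] bounded_clinear_scale[OF F] scaleC_scaleC
        complex_vector.scale_right_diff_distrib complex_vector.scale_left_diff_distrib algebra_simps)
  ultimately have "shift_op F a y - (d * (\<mu> k - a)) *\<^sub>C v k \<in> flag v k"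
    using y by (simp only: complex_vector.span_add complex_vector.span_diff complex_vector.span_scale)
  then show ?case by (simp add: d_def y_def mult.commute mult.left_commute)
qed

lemma funpow_shift_op_diagonal:
  assumes F: "bounded_clinear F" and tri: "triangular_basis F v \<mu> n" and k: "k < n"
    and x: "x - c *\<^sub>C v k \<in> flag v k"
  shows "(shift_op F a ^^ N) x - (c * (\<mu> k - a) ^ N) *\<^sub>C v k \<in> flag v k"
proof -
  have "foldr (shift_op F) (replicate N a) x = (shift_op F a ^^ N) x" by (induction N) auto
  then show ?thesis
    using foldr_shift_op_diagonal[OF F tri k x, where as = "replicate N a"] by simp
qed

text \<open>The Cayley--Hamilton theorem for the triangular form.\<close>

lemma foldr_shift_op_annihilates:
  assumes F: "bounded_clinear F" and tri: "triangular_basis F v \<mu> n" and "k \<le> n" and "x \<in> flag v k"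
  shows "foldr (shift_op F) (map \<mu> [0..<k]) x = 0"
  using assms(3,4)
proof (induction k arbitrary: x)
  case (Suc k)
  obtain c where c: "x - c *\<^sub>C v k \<in> flag v k" using Suc.prems(2) flag_Suc by blast
  have "shift_op F (\<mu> k) x \<in> flag v k"
    using funpow_shift_op_diagonal[OF F tri _ c, where a = "\<mu> k" and N = 1] Suc.prems(1) by simp
  then show ?case using Suc by simp
qed simp

section \<open>Generalized eigenspaces and the determinant in triangular form\<close>

definition generalized_eigenspace :: "('h::complex_hilbert \<Rightarrow> 'h) \<Rightarrow> complex \<Rightarrow> 'h set" where
  "generalized_eigenspace F a = {x. \<exists>N. (shift_op F a ^^ N) x = 0}"

lemma funpow_zero_mono:
  assumes F: "bounded_clinear F" and "(F ^^ N) x = 0" "N \<le> M"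
  shows "(F ^^ M) x = 0"
proof -
  have "(F ^^ M) x = (F ^^ (M - N)) ((F ^^ N) x)"
    using assms(3) by (metis comp_apply funpow_add le_add_diff_inverse2)
  then show ?thesis using assms(2) bounded_clinear_0[OF bounded_clinear_funpow[OF F]] by simp
qed

lemma generalized_eigenspace_subspace:
  assumes F: "bounded_clinear F"
  shows "complex_vector.subspace (generalized_eigenspace F a)"
proof -
  note D = bounded_clinear_shift_op[OF F, of a]
  note Dn = bounded_clinear_funpow[OF D]
  have "x + y \<in> generalized_eigenspace F a"
    if xy: "x \<in> generalized_eigenspace F a" "y \<in> generalized_eigenspace F a" for x y
  proof -
    obtain N M where "(shift_op F a ^^ N) x = 0" "(shift_op F a ^^ M) y = 0"
      using xy unfolding generalized_eigenspace_def by blast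
    then have "(shift_op F a ^^ max N M) (x + y) = 0"
      using funpow_zero_mono[OF D] by (simp add: bounded_clinear_add[OF Dn])
    then show ?thesis unfolding generalized_eigenspace_def by blast
  qed
  moreover have "0 \<in> generalized_eigenspace F a"
    unfolding generalized_eigenspace_def by (auto intro!: exI[of _ 0])
  moreover have "c *\<^sub>C x \<in> generalized_eigenspace F a" if "x \<in> generalized_eigenspace F a" for c x
    using that by (auto simp: generalized_eigenspace_def bounded_clinear_scale[OF Dn])
  ultimately show ?thesis by (auto simp: complex_vector.subspace_def)
qed

text \<open>For nonzero \<open>a\<close> any \<open>y\<close> is recovered as \<open>1 / a\<close>
  times the difference of \<open>F y\<close> and \<open>shift_op F a y\<close>. So membership in the
  flag passes backwards along the chain that ends in 0.\<close>

lemma generalized_eigenspace_subset_flag: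
  assumes V: "range F \<subseteq> flag v n" and a: "a \<noteq> 0"
  shows "generalized_eigenspace F a \<subseteq> flag v n"
proof
  fix x
  assume "x \<in> generalized_eigenspace F a"
  then obtain N where "(shift_op F a ^^ N) x = 0" by (auto simp: generalized_eigenspace_def)
  then have "(shift_op F a ^^ N) x \<in> flag v n" by (simp add: complex_vector.span_zero)
  then show "x \<in> flag v n"
  proof (induction N)
    case (Suc N)
    let ?y = "(shift_op F a ^^ N) x"
    have "?y = (1 / a) *\<^sub>C (F ?y - shift_op F a ?y)"
      using a by (simp add: scaleC_scaleC scaleC_one)
    also have "\<dots> \<in> flag v n"
    proof (rule complex_vector.span_scale[OF complex_vector.span_diff])
      show "F ?y \<in> flag v n" using V by blast
      show "shift_op F a ?y \<in> flag v n" using Suc.prems by simp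
    qed
    finally show ?case by (rule Suc.IH)
  qed simp
qed

text \<open>If \<open>\<mu> k = a\<close>, applying the factors \<open>F - \<mu> i\<close> with \<open>i < k\<close>, \<open>\<mu> i \<noteq> a\<close> to \<open>v k\<close> gives
  a generalized eigenvector whose \<open>v k\<close>-coefficient does not vanish.\<close>

lemma generalized_eigenspace_jump:
  assumes F: "bounded_clinear F" and tri: "triangular_basis F v \<mu> n" and k: "k < n"
  shows "(\<exists>x\<in>generalized_eigenspace F a. x \<in> flag v (Suc k) \<and> x \<notin> flag v k) \<longleftrightarrow> \<mu> k = a"
proof
  have on: "orthonormal_on v {..<n}" using tri by (simp add: triangular_basis_def)
  {
    assume "\<exists>x\<in>generalized_eigenspace F a. x \<in> flag v (Suc k) \<and> x \<notin> flag v k"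
    then obtain x N c where x: "(shift_op F a ^^ N) x = 0" "x - c *\<^sub>C v k \<in> flag v k" "x \<notin> flag v k"
      unfolding generalized_eigenspace_def flag_Suc by blast
    have "- ((c * (\<mu> k - a) ^ N) *\<^sub>C v k) \<in> flag v k"
      using funpow_shift_op_diagonal[OF F tri k x(2), where a = a and N = N] x(1) by simp
    then have "(c * (\<mu> k - a) ^ N) *\<^sub>C v k \<in> flag v k"
      using complex_vector.span_neg by fastforce
    then have "c * (\<mu> k - a) ^ N = 0" using flag_not_mem[OF on k] by blast
    moreover have "c \<noteq> 0" using x(2,3) by auto
    ultimately show "\<mu> k = a" by auto
  next
    assume a: "\<mu> k = a"
    define as where "as = filter (\<lambda>b. b \<noteq> a) (map \<mu> [0..<k])"
    define y where "y = foldr (shift_op F) as (v k)"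
    define p where "p = (\<Prod>b\<leftarrow>as. \<mu> k - b)"
    have y: "y - p *\<^sub>C v k \<in> flag v k"
      using foldr_shift_op_diagonal[OF F tri k, where x = "v k" and c = 1 and as = as]
      by (simp add: y_def p_def scaleC_one complex_vector.span_zero)
    have "p \<noteq> 0" unfolding p_def prod_list_zero_iff using a by (auto simp: as_def)
    then have yk: "y \<notin> flag v k"
      using y flag_not_mem[OF on k, of p] complex_vector.span_diff[of y "v ` {..<k}" "y - p *\<^sub>C v k"]
      by auto
    have ySuc: "y \<in> flag v (Suc k)" using y flag_Suc by blast
    \<comment> \<open>The full product over the flag of length \<open>Suc k\<close> kills
      \<open>v k\<close>; gathering its factors for \<open>a\<close> outside leaves a power of
      \<open>F - a\<close> applied to \<open>y\<close>.\<close>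
    have "foldr (shift_op F) (map \<mu> [0..<Suc k]) (v k) = 0"
      using foldr_shift_op_annihilates[OF F tri, of "Suc k" "v k"] k flag_base[of k "Suc k" v] by simp
    moreover have "filter (\<lambda>b. b \<noteq> a) (map \<mu> [0..<Suc k]) = as" using a by (simp add: as_def)
    ultimately have "(shift_op F a ^^ length (filter (\<lambda>b. b = a) (map \<mu> [0..<Suc k]))) y = 0"
      using foldr_shift_op_filter[OF F, where as = "map \<mu> [0..<Suc k]" and x = "v k" and a = a]
      by (simp only: y_def)
    then have "y \<in> generalized_eigenspace F a"
      unfolding generalized_eigenspace_def by blast
    with yk ySuc show "\<exists>x\<in>generalized_eigenspace F a. x \<in> flag v (Suc k) \<and> x \<notin> flag v k" by blast
  }
qed

text \<open>The last nonzero vector of the chain is an eigenvector.\<close>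

lemma eigenvector_of_generalized:
  assumes "(shift_op F a ^^ N) x = 0" "x \<noteq> 0"
  shows "a \<in> eigenvalues F"
  using assms
proof (induction N)
  case (Suc N)
  show ?case
  proof (cases "(shift_op F a ^^ N) x = 0")
    case False
    then show ?thesis using Suc.prems(1) by (auto simp: eigenvalues_def)
  qed (use Suc in blast)
qed simp

text \<open>For nonzero \<open>a\<close> the generalized eigenspace lies in the flag and jumps
  exactly at the indices with \<open>\<mu> k = a\<close>. Their number is the algebraic
  multiplicity, so the product over eigenvalues regroups into the product over the diagonal.\<close>

lemma Det_finite_rank_triangular:
  assumes F: "bounded_clinear F" and tri: "triangular_basis F v \<mu> n" and V: "range F \<subseteq> flag v n"
  shows "Det_finite_rank F = (\<Prod>k<n. 1 + \<mu> k)"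
proof -
  have G: "alg_multiplicity F a = card {k. k < n \<and> \<mu> k = a} \<and>
      (a \<in> eigenvalues F \<longleftrightarrow> a \<in> \<mu> ` {..<n})" if a: "a \<noteq> 0" for a
  proof -
    let ?G = "generalized_eigenspace F a"
    obtain B where B: "finite B" "\<not> complex_vector.dependent B" "cspan B = ?G \<inter> flag v n"
      "card B = card {k. k < n \<and> (\<exists>x\<in>?G. x \<in> flag v (Suc k) \<and> x \<notin> flag v k)}"
      using dim_flag_intersection[OF generalized_eigenspace_subspace[OF F]] by blast
    have "cspan B = ?G" using B(3) generalized_eigenspace_subset_flag[OF V a] by blast
    moreover have card_B: "card B = card {k. k < n \<and> \<mu> k = a}"
      unfolding B(4) using generalized_eigenspace_jump[OF F tri, of _ a] by (metis (mono_tags, lifting))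
    ultimately have "alg_multiplicity F a = card {k. k < n \<and> \<mu> k = a}"
      using complex_vector.dim_span_eq_card_independent[OF B(2)]
      unfolding alg_multiplicity_def generalized_eigenspace_def by simp
    moreover have "a \<in> eigenvalues F" if "a \<in> \<mu> ` {..<n}"
    proof -
      from that obtain k where k: "k < n" "\<mu> k = a" by auto
      then obtain x where "x \<in> ?G" "x \<notin> flag v k" using generalized_eigenspace_jump[OF F tri k(1)] by blast
      moreover from this have "x \<noteq> 0" using complex_vector.span_zero by metis
      ultimately show ?thesis using eigenvector_of_generalized by (auto simp: generalized_eigenspace_def)
    qed
    moreover have "a \<in> \<mu> ` {..<n}" if "a \<in> eigenvalues F"
    proof -
      from that obtain x where x: "x \<noteq> 0" "F x = a *\<^sub>C x" by (auto simp: eigenvalues_def)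
      then have "x \<in> ?G" unfolding generalized_eigenspace_def by (auto intro!: exI[of _ 1])
      then have "B \<noteq> {}" using \<open>cspan B = ?G\<close> x(1) by auto
      then have "card {k. k < n \<and> \<mu> k = a} \<noteq> 0" using B(1) card_B by (metis card_0_eq)
      then have "{k. k < n \<and> \<mu> k = a} \<noteq> {}" by (metis card.empty)
      then show ?thesis by auto
    qed
    ultimately show ?thesis by blast
  qed
  have "eigenvalues F - {0} = \<mu> ` {..<n} - {0}" using G by auto
  then have "Det_finite_rank F = (\<Prod>a\<in>\<mu> ` {..<n} - {0}. (1 + a) ^ card {k. k < n \<and> \<mu> k = a})"
    unfolding Det_finite_rank_def using G by (intro prod.cong) auto
  \<comment> \<open>A diagonal entry 0 may be put back: it contributes the factor 1.\<close>
  also have "\<dots> = (\<Prod>a\<in>\<mu> ` {..<n}. (1 + a) ^ card {k. k < n \<and> \<mu> k = a})"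
    by (intro prod.mono_neutral_left) auto
  also have "\<dots> = (\<Prod>a\<in>\<mu> ` {..<n}. \<Prod>k\<in>{k \<in> {..<n}. \<mu> k = a}. 1 + \<mu> k)"
    by (intro prod.cong) auto
  also have "\<dots> = (\<Prod>k<n. 1 + \<mu> k)"
    by (rule prod.image_gen[symmetric]) simp
  finally show ?thesis .
qed

lemma triangular_basis_cinner_funpow:
  assumes F: "bounded_clinear F" and tri: "triangular_basis F v \<mu> n" and k: "k < n"
  shows "cinner ((F ^^ p) (v k)) (v k) = \<mu> k ^ p"
proof -
  have on: "orthonormal_on v {..<n}" using tri by (simp add: triangular_basis_def)
  \<comment> \<open>The shift by 0 turns the powers of \<open>F - a\<close> into powers of
    \<open>F\<close>.\<close>
  have mem: "(F ^^ p) (v k) - \<mu> k ^ p *\<^sub>C v k \<in> flag v k"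
    using funpow_shift_op_diagonal[OF F tri k, where x = "v k" and c = 1 and a = 0 and N = p]
    by (simp add: scaleC_one complex_vector.span_zero)
  have "cinner (v k) ((F ^^ p) (v k) - \<mu> k ^ p *\<^sub>C v k) = 0"
    by (rule cspan_cinner_zero[OF _ mem]) (use on k in \<open>auto simp: orthonormal_on_def\<close>)
  then have "cinner ((F ^^ p) (v k) - \<mu> k ^ p *\<^sub>C v k) (v k) = 0"
    by (metis cinner_commute complex_cnj_zero)
  then show ?thesis
    using on k by (simp add: cinner_simps orthonormal_on_def)
qed

text \<open>Independence of the trace from the basis. Expanding \<open>A (b i)\<close> in the
  finitely many \<open>v k\<close> makes the diagonal sum a finite sum of Parseval series, one for
  each \<open>k\<close>.\<close>

lemma has_sum_trace_finite_rank:
  assumes A: "bounded_clinear A" and v: "orthonormal_on v {..<n}" and V: "range A \<subseteq> flag v n"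
    and b: "orthonormal_basis b I"
  shows "((\<lambda>i. cinner (A (b i)) (b i)) has_sum (\<Sum>k<n. cinner (A (v k)) (v k))) I"
proof -
  have "((\<lambda>i. \<Sum>k<n. cinner (v k) (b i) * cinner (b i) (cadjoint A (v k))) has_sum
      (\<Sum>k<n. cinner (v k) (cadjoint A (v k)))) I"
    by (induction n) (auto intro: has_sum_add parseval[OF b])
  moreover have "(\<Sum>k<n. cinner (v k) (b i) * cinner (b i) (cadjoint A (v k))) = cinner (A (b i)) (b i)" for i
  proof -
    have "ortho_proj v {..<n} (A (b i)) = A (b i)"
      using v V by (intro ortho_proj_span) auto
    then have "cinner (A (b i)) (b i) = cinner (ortho_proj v {..<n} (A (b i))) (b i)" by simp
    then show ?thesis
      by (simp add: ortho_proj_def cinner_simps cinner_cadjoint[OF A] mult.commute)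
  qed
  moreover have "cinner (v k) (cadjoint A (v k)) = cinner (A (v k)) (v k)" for k
    by (simp add: cinner_cadjoint[OF A])
  ultimately show ?thesis by simp
qed

text \<open>The trace of each power is the power sum of the diagonal \<open>\<mu>\<close>, whose
  entries have modulus at most \<open>c\<close> because they are diagonal coefficients of
  \<open>F\<close>. Hence all logarithmic series converge, and finitely many of them can be
  added.\<close>

lemma Det_finite_rank_exp:
  assumes F: "finite_rank F" and b: "orthonormal_basis b I"
    and c: "\<And>x. norm (F x) \<le> c * norm x" "c < 1"
  shows "\<And>p. (\<lambda>i. cinner ((F ^^ Suc p) (b i)) (b i)) summable_on I"
    and "\<exists>L. (\<lambda>p. (-1) ^ (Suc p + 1) / of_nat (Suc p) * (\<Sum>\<^sub>\<infinity>i\<in>I. cinner ((F ^^ Suc p) (b i)) (b i))) sums L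
      \<and> Det_finite_rank F = exp L"
proof -
  obtain v \<mu> n where tri: "triangular_basis F v \<mu> n" and V: "range F \<subseteq> flag v n"
    using triangular_basis_exists[OF F] .
  have F': "bounded_clinear F" using F by (simp add: finite_rank_def)
  have on: "orthonormal_on v {..<n}" using tri by (simp add: triangular_basis_def)
  have tr: "((\<lambda>i. cinner ((F ^^ Suc p) (b i)) (b i)) has_sum (\<Sum>k<n. \<mu> k ^ Suc p)) I" for p
  proof -
    have "range (F ^^ Suc p) \<subseteq> flag v n" using V by auto
    from has_sum_trace_finite_rank[OF bounded_clinear_funpow[OF F'] on this b]
    show ?thesis
      using triangular_basis_cinner_funpow[OF F' tri, of _ "Suc p"] by (simp del: funpow.simps)
  qed
  then show "(\<lambda>i. cinner ((F ^^ Suc p) (b i)) (b i)) summable_on I" for p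
    using has_sum_imp_summable by blast
  have \<mu>: "cmod (\<mu> k) < 1" if k: "k < n" for k
  proof -
    have "cmod (\<mu> k) = cmod (cinner (F (v k)) (v k))"
      using triangular_basis_cinner_funpow[OF F' tri k, of 1] by simp
    also have "\<dots> \<le> norm (F (v k)) * norm (v k)" by (rule cauchy_schwarz)
    also have "\<dots> \<le> c" using orthonormal_on_norm[OF on, of k] k c(1)[of "v k"] by simp
    finally show ?thesis using c(2) by simp
  qed
  have "(\<lambda>p. \<Sum>k<n. (-1) ^ (Suc p + 1) / of_nat (Suc p) * \<mu> k ^ Suc p) sums (\<Sum>k<n. ln (1 + \<mu> k))"
  proof (rule sums_sum)
    fix k
    assume "k \<in> {..<n}"
    \<comment> \<open>This series starts at 0, where division by 0 makes the term 0; dropping it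
      shifts the index to \<open>Suc p\<close>.\<close>
    then have "(\<lambda>p. (-1) ^ Suc p / of_nat p * \<mu> k ^ p) sums ln (1 + \<mu> k)"
      using \<mu> by (intro Ln_series) simp
    then show "(\<lambda>p. (-1) ^ (Suc p + 1) / of_nat (Suc p) * \<mu> k ^ Suc p) sums ln (1 + \<mu> k)"
      using sums_Suc_iff[of "\<lambda>p. (-1) ^ Suc p / of_nat p * \<mu> k ^ p" "ln (1 + \<mu> k)"] by simp
  qed
  then have "(\<lambda>p. (-1) ^ (Suc p + 1) / of_nat (Suc p) *
      (\<Sum>\<^sub>\<infinity>i\<in>I. cinner ((F ^^ Suc p) (b i)) (b i))) sums (\<Sum>k<n. ln (1 + \<mu> k))"
    using infsumI[OF tr] by (simp add: sum_distrib_left del: funpow.simps power_Suc)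
  moreover have "exp (\<Sum>k<n. ln (1 + \<mu> k)) = Det_finite_rank F"
  proof -
    have "1 + \<mu> k \<noteq> 0" if "k < n" for k
      using \<mu>[OF that] by (metis add_eq_0_iff norm_minus_cancel norm_one less_irrefl)
    then show ?thesis
      unfolding Det_finite_rank_triangular[OF F' tri V] by (subst exp_sum) (auto intro!: prod.cong)
  qed
  ultimately show "\<exists>L. (\<lambda>p. (-1) ^ (Suc p + 1) / of_nat (Suc p) *
      (\<Sum>\<^sub>\<infinity>i\<in>I. cinner ((F ^^ Suc p) (b i)) (b i))) sums L \<and> Det_finite_rank F = exp L"
    by (metis (no_types, lifting))
qed

section \<open>Traces of powers and continuity of the determinant\<close>

lemma infsum_norm_bound:
  fixes f :: "'i \<Rightarrow> complex"
  assumes bound: "\<And>J. finite J \<Longrightarrow> J \<subseteq> I \<Longrightarrow> (\<Sum>i\<in>J. cmod (f i)) \<le> C"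
  shows "f summable_on I" "cmod (infsum f I) \<le> C"
proof -
  have "(\<lambda>i. cmod (f i)) summable_on I"
    by (rule nonneg_bdd_above_summable_on) (auto intro!: bdd_aboveI[where M = C] bound)
  then show "f summable_on I" "cmod (infsum f I) \<le> C"
    using abs_summable_summable norm_infsum_bound[of f I] infsum_le_finite_sums[OF _ bound]
    by (auto intro: order_trans)
qed

lemma trace_summable:
  assumes A: "trace_class A" and X: "bounded_clinear X" and Y: "bounded_clinear Y"
    and b: "orthonormal_basis b I"
  shows "(\<lambda>i. cinner (X (A (Y (b i)))) (b i)) summable_on I"
    "cmod (\<Sum>\<^sub>\<infinity>i\<in>I. cinner (X (A (Y (b i)))) (b i)) \<le> onorm X * onorm Y * trace_norm A"
  using infsum_norm_bound[of I "\<lambda>i. cinner (X (A (Y (b i)))) (b i)" "onorm X * onorm Y * trace_norm A"]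
    sum_cinner_le_trace_norm[OF A X Y] orthonormal_on_subset[OF orthonormal_basis_on[OF b]]
  by blast+

lemma onorm_funpow_le:
  assumes "bounded_clinear F" and c: "\<And>x. norm (F x) \<le> c * norm x" "0 \<le> c"
  shows "onorm (F ^^ n) \<le> c ^ n"
proof (rule onorm_bound)
  show "norm ((F ^^ n) x) \<le> c ^ n * norm x" for x
  proof (induction n)
    case (Suc n)
    have "norm ((F ^^ Suc n) x) \<le> c * norm ((F ^^ n) x)" by (simp add: c(1))
    also have "\<dots> \<le> c * (c ^ n * norm x)" by (intro mult_left_mono Suc.IH c(2))
    finally show ?case by (simp add: mult.assoc)
  qed simp
qed (simp add: c(2))

text \<open>The operators need not commute, so powers of \<open>F\<close> stay on the left and
  powers of \<open>S\<close> on the right of a single difference. This is the shape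
  \<open>X A Y\<close> of the trace bound.\<close>

lemma funpow_diff_telescope:
  assumes F: "bounded_clinear F"
  shows "(F ^^ n) x - (S ^^ n) x =
    (\<Sum>j<n. (F ^^ j) (F ((S ^^ (n - Suc j)) x) - S ((S ^^ (n - Suc j)) x)))"
proof (induction n)
  case (Suc n)
  have "(F ^^ Suc n) x - (S ^^ Suc n) x =
      F ((F ^^ n) x - (S ^^ n) x) + (F ((S ^^ n) x) - S ((S ^^ n) x))"
    by (simp add: bounded_clinear_diff[OF F])
  then show ?case
    by (simp add: Suc.IH bounded_clinear_sum[OF F] sum.lessThan_Suc_shift del: sum.lessThan_Suc)
qed simp

text \<open>Each of the \<open>Suc n\<close> telescoped terms costs at most \<open>c ^ n\<close>
  times the trace norm of the difference. The factor \<open>Suc n\<close> will cancel against the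
  denominator in the logarithmic series.\<close>

lemma trace_funpow_diff_le:
  assumes F: "bounded_clinear F" and S: "bounded_clinear S"
    and A: "trace_class (\<lambda>x. F x - S x)"
    and c: "\<And>x. norm (F x) \<le> c * norm x" "\<And>x. norm (S x) \<le> c * norm x" "0 \<le> c"
    and b: "orthonormal_basis b I"
  shows "cmod (\<Sum>\<^sub>\<infinity>i\<in>I. cinner ((F ^^ Suc n) (b i) - (S ^^ Suc n) (b i)) (b i))
    \<le> real (Suc n) * c ^ n * trace_norm (\<lambda>x. F x - S x)"
proof (rule infsum_norm_bound)
  fix J
  assume J: "finite J" "J \<subseteq> I"
  have on: "orthonormal_on b J"
    using orthonormal_on_subset[OF orthonormal_basis_on[OF b] J(2)] .
  define f where "f j i = cinner ((F ^^ j) (F ((S ^^ (Suc n - Suc j)) (b i)) - S ((S ^^ (Suc n - Suc j)) (b i)))) (b i)" for j i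
  have "(\<Sum>i\<in>J. cmod (cinner ((F ^^ Suc n) (b i) - (S ^^ Suc n) (b i)) (b i)))
      \<le> (\<Sum>i\<in>J. \<Sum>j<Suc n. cmod (f j i))"
    unfolding funpow_diff_telescope[OF F] cinner_sum_left f_def by (intro sum_mono norm_sum)
  also have "\<dots> = (\<Sum>j<Suc n. \<Sum>i\<in>J. cmod (f j i))" by (rule sum.swap)
  also have "\<dots> \<le> (\<Sum>j<Suc n. c ^ n * trace_norm (\<lambda>x. F x - S x))"
  proof (rule sum_mono)
    fix j
    assume j: "j \<in> {..<Suc n}"
    have "(\<Sum>i\<in>J. cmod (f j i))
        \<le> onorm (F ^^ j) * onorm (S ^^ (Suc n - Suc j)) * trace_norm (\<lambda>x. F x - S x)"
      unfolding f_def
      using sum_cinner_le_trace_norm[OF A bounded_clinear_funpow[OF F] bounded_clinear_funpow[OF S] on J(1)] .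
    also have "\<dots> \<le> c ^ j * c ^ (Suc n - Suc j) * trace_norm (\<lambda>x. F x - S x)"
      by (intro mult_mono onorm_funpow_le F S c mult_nonneg_nonneg onorm_pos_le zero_le_power
          bounded_clinear_linear bounded_clinear_funpow trace_norm_nonneg A order_refl)
    also have "c ^ j * c ^ (Suc n - Suc j) = c ^ n"
      using j by (simp flip: power_add)
    finally show "(\<Sum>i\<in>J. cmod (f j i)) \<le> c ^ n * trace_norm (\<lambda>x. F x - S x)" .
  qed
  finally show "(\<Sum>i\<in>J. cmod (cinner ((F ^^ Suc n) (b i) - (S ^^ Suc n) (b i)) (b i)))
      \<le> real (Suc n) * c ^ n * trace_norm (\<lambda>x. F x - S x)"
    by simp
qed

lemma trace_class_powers:
  assumes T: "trace_class T" and b: "orthonormal_basis b I"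
  shows "(\<lambda>i. cinner ((T ^^ Suc n) (b i)) (b i)) summable_on I"
    "cmod (\<Sum>\<^sub>\<infinity>i\<in>I. cinner ((T ^^ Suc n) (b i)) (b i)) \<le> trace_norm T ^ Suc n"
proof -
  have T': "bounded_clinear T" using T by (rule trace_class_singular_values)
  note Tn = bounded_clinear_funpow[OF T', of n]
  have eq: "(T ^^ n) (T (b i)) = (T ^^ Suc n) (b i)" for i by (simp add: funpow_swap1)
  note tr = trace_summable[OF T Tn bounded_clinear_id b, unfolded eq]
  show "(\<lambda>i. cinner ((T ^^ Suc n) (b i)) (b i)) summable_on I" by (rule tr(1))
  \<comment> \<open>Only an inequality, since the operator norm of the identity is 0 on the zero
    space.\<close>
  have "onorm (\<lambda>x::'a. x) \<le> 1" by (rule onorm_bound) auto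
  moreover have "onorm (T ^^ n) \<le> trace_norm T ^ n"
    by (intro onorm_funpow_le T' norm_le_trace_norm T trace_norm_nonneg)
  ultimately have "onorm (T ^^ n) * onorm (\<lambda>x::'a. x) * trace_norm T \<le> trace_norm T ^ n * 1 * trace_norm T"
    by (intro mult_mono trace_norm_nonneg T zero_le_power mult_nonneg_nonneg onorm_pos_le
        bounded_linear_ident) auto
  with tr(2) show "cmod (\<Sum>\<^sub>\<infinity>i\<in>I. cinner ((T ^^ Suc n) (b i)) (b i)) \<le> trace_norm T ^ Suc n"
    by (simp add: mult.commute)
qed

text \<open>Both operators have norm at most 1/2, so the exponents differ in the \<open>n\<close>-th
  term by at most \<open>(1 / 2) ^ n\<close> times the trace norm of \<open>F - S\<close>. Summation
  gives the factor 2 and makes the exponent Lipschitz at \<open>S\<close>.\<close>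

lemma Det_finite_rank_dist_le:
  assumes F: "finite_rank F" and S: "bounded_clinear S" and A: "trace_class (\<lambda>x. F x - S x)"
    and S_le: "\<And>x. norm (S x) \<le> 1 / 4 * norm x" and A_le: "trace_norm (\<lambda>x. F x - S x) \<le> 1 / 4"
    and b: "orthonormal_basis b I"
    and S_sum: "\<And>n. (\<lambda>i. cinner ((S ^^ Suc n) (b i)) (b i)) summable_on I"
    and S_sums: "(\<lambda>n. (-1) ^ (Suc n + 1) / of_nat (Suc n) * (\<Sum>\<^sub>\<infinity>i\<in>I. cinner ((S ^^ Suc n) (b i)) (b i))) sums L"
  shows "\<exists>L'. Det_finite_rank F = exp L' \<and> dist L' L \<le> 2 * trace_norm (\<lambda>x. F x - S x)"
proof -
  have F': "bounded_clinear F" using F by (simp add: finite_rank_def)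
  let ?t = "trace_norm (\<lambda>x. F x - S x)"
  let ?a = "\<lambda>n. (-1) ^ (Suc n + 1) / of_nat (Suc n) :: complex"
  have F_le: "norm (F x) \<le> 1 / 2 * norm x" for x
  proof -
    have "norm (F x) \<le> norm (F x - S x) + norm (S x)" using norm_triangle_ineq[of "F x - S x" "S x"] by simp
    moreover have "norm (F x - S x) \<le> ?t * norm x" by (rule norm_le_trace_norm[OF A])
    moreover have "?t * norm x \<le> 1 / 4 * norm x" using A_le by (rule mult_right_mono) simp
    ultimately show ?thesis using S_le[of x] by simp
  qed
  have S_le': "norm (S x) \<le> 1 / 2 * norm x" for x using S_le[of x] norm_ge_zero[of x] by linarith
  obtain L' where L': "(\<lambda>n. ?a n * (\<Sum>\<^sub>\<infinity>i\<in>I. cinner ((F ^^ Suc n) (b i)) (b i))) sums L'"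
    "Det_finite_rank F = exp L'"
    using Det_finite_rank_exp(2)[OF F b F_le] by auto
  have F_sum: "(\<lambda>i. cinner ((F ^^ Suc n) (b i)) (b i)) summable_on I" for n
    using Det_finite_rank_exp(1)[OF F b F_le] by simp
  define D where "D n = (\<Sum>\<^sub>\<infinity>i\<in>I. cinner ((F ^^ Suc n) (b i) - (S ^^ Suc n) (b i)) (b i))" for n
  have D: "D n = (\<Sum>\<^sub>\<infinity>i\<in>I. cinner ((F ^^ Suc n) (b i)) (b i)) - (\<Sum>\<^sub>\<infinity>i\<in>I. cinner ((S ^^ Suc n) (b i)) (b i))" for n
    using infsum_add[OF F_sum[of n] summable_on_uminus[THEN iffD2, OF S_sum[of n]]]
    unfolding D_def cinner_diff_left by (simp add: infsum_uminus del: funpow.simps)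
  have sums: "(\<lambda>n. ?a n * D n) sums (L' - L)"
    unfolding D right_diff_distrib by (rule sums_diff[OF L'(1) S_sums])
  have le: "cmod (?a n * D n) \<le> (1 / 2) ^ n * ?t" for n
  proof -
    have "cmod (D n) \<le> real (Suc n) * (1 / 2) ^ n * ?t"
      unfolding D_def by (rule trace_funpow_diff_le[OF F' S A F_le S_le' _ b]) simp
    moreover have "cmod (?a n * D n) = cmod (D n) / real (Suc n)"
      by (simp add: norm_mult norm_divide norm_power del: of_nat_Suc)
    ultimately show ?thesis by (simp add: divide_le_eq mult_ac del: of_nat_Suc)
  qed
  have geo: "(\<lambda>n. (1 / 2) ^ n * ?t) sums (2 * ?t)"
    using sums_mult2[OF geometric_sums[of "1 / 2 :: real"], of ?t] by simp
  have "cmod (L' - L) \<le> 2 * ?t"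
    using norm_suminf_le[OF le sums_summable[OF geo]] sums_unique[OF sums] sums_unique[OF geo] by simp
  then show ?thesis using L'(2) by (auto simp: dist_norm)
qed

text \<open>Existence of the limit is the Lipschitz estimate for the exponent combined with
  continuity of \<open>exp\<close>; uniqueness comes from the approximants of finite rank.\<close>

lemma Det_I_plus_eq_exp:
  assumes T: "trace_class T" and b: "orthonormal_basis b I" and z: "cmod z * trace_norm T \<le> 1 / 4"
  defines "f \<equiv> \<lambda>n. (-1) ^ (Suc n + 1) / of_nat (Suc n) * z ^ Suc n *
    (\<Sum>\<^sub>\<infinity>i\<in>I. cinner ((T ^^ Suc n) (b i)) (b i))"
  shows "summable f" "Det_I_plus (\<lambda>x. z *\<^sub>C T x) = exp (suminf f)"
proof -
  have T': "bounded_clinear T" using T by (rule trace_class_singular_values)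
  define S where "S x = z *\<^sub>C T x" for x
  have S': "bounded_clinear S" unfolding S_def by (rule bounded_clinear_scaleC[OF T'])
  have pow: "(S ^^ n) x = z ^ n *\<^sub>C (T ^^ n) x" for n x
    by (induction n) (simp_all add: S_def scaleC_one bounded_clinear_scale[OF T'] scaleC_scaleC)
  have t0: "0 \<le> trace_norm T" by (rule trace_norm_nonneg[OF T])
  have "cmod (f n) \<le> (1 / 4) ^ Suc n" for n
  proof -
    have "cmod (f n) = cmod z ^ Suc n * cmod (\<Sum>\<^sub>\<infinity>i\<in>I. cinner ((T ^^ Suc n) (b i)) (b i)) / real (Suc n)"
      unfolding f_def by (simp add: norm_mult norm_divide norm_power del: of_nat_Suc power_Suc funpow.simps)
    also have "\<dots> \<le> cmod z ^ Suc n * trace_norm T ^ Suc n / 1"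
      by (intro frac_le mult_left_mono trace_class_powers[OF T b]) (auto simp: t0)
    also have "\<dots> = (cmod z * trace_norm T) ^ Suc n" by (simp add: power_mult_distrib)
    also have "\<dots> \<le> (1 / 4) ^ Suc n" using z t0 by (intro power_mono) auto
    finally show ?thesis .
  qed
  then show sm: "summable f"
    by (rule summable_comparison_test'[rotated]) (intro summable_Suc_iff[THEN iffD2] summable_geometric, simp)
  define L where "L = suminf f"
  have tr_S: "cinner ((S ^^ Suc n) (b i)) (b i) = z ^ Suc n * cinner ((T ^^ Suc n) (b i)) (b i)" for n i
    unfolding pow by (rule cinner_scaleC_left)
  have S_sum: "(\<lambda>i. cinner ((S ^^ Suc n) (b i)) (b i)) summable_on I" for n
    unfolding tr_S by (intro summable_on_cmult_right trace_class_powers[OF T b])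
  have S_sums: "(\<lambda>n. (-1) ^ (Suc n + 1) / of_nat (Suc n) * (\<Sum>\<^sub>\<infinity>i\<in>I. cinner ((S ^^ Suc n) (b i)) (b i))) sums L"
    using summable_sums[OF sm] unfolding tr_S infsum_cmult_right' L_def f_def by (simp only: mult.assoc)
  have S_le: "norm (S x) \<le> 1 / 4 * norm x" for x
  proof -
    have "norm (S x) = cmod z * norm (T x)" by (simp add: S_def)
    also have "\<dots> \<le> cmod z * (trace_norm T * norm x)" by (intro mult_left_mono norm_le_trace_norm T) auto
    also have "\<dots> = (cmod z * trace_norm T) * norm x" by simp
    also have "\<dots> \<le> 1 / 4 * norm x" using z by (rule mult_right_mono) simp
    finally show ?thesis .
  qed
  have lim: "\<exists>\<delta>>0. \<forall>F. finite_rank F \<and> trace_class (\<lambda>x. F x - S x) \<and>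
      trace_norm (\<lambda>x. F x - S x) < \<delta> \<longrightarrow> dist (Det_finite_rank F) (exp L) < \<epsilon>"
    if \<epsilon>: "0 < \<epsilon>" for \<epsilon>
  proof -
    obtain \<eta> where \<eta>: "0 < \<eta>" "\<And>L'. dist L' L < \<eta> \<Longrightarrow> dist (exp L') (exp L) < \<epsilon>"
      using isCont_exp[of L] \<epsilon> unfolding continuous_at_eps_delta by metis
    show ?thesis
    \<comment> \<open>1/4 is the range of the Lipschitz estimate, and \<open>\<eta> / 2\<close>
      absorbs its constant 2.\<close>
    proof (intro exI[of _ "min (1 / 4) (\<eta> / 2)"] conjI allI impI)
      show "0 < min (1 / 4) (\<eta> / 2)" using \<eta>(1) by simp
      fix F
      assume F: "finite_rank F \<and> trace_class (\<lambda>x. F x - S x) \<and>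
        trace_norm (\<lambda>x. F x - S x) < min (1 / 4) (\<eta> / 2)"
      then obtain L' where "Det_finite_rank F = exp L'" "dist L' L \<le> 2 * trace_norm (\<lambda>x. F x - S x)"
        using Det_finite_rank_dist_le[OF _ S' _ S_le _ b S_sum S_sums, of F] by auto
      then show "dist (Det_finite_rank F) (exp L) < \<epsilon>" using \<eta>(2)[of L'] F by simp
    qed
  qed
  have "Det_I_plus S = exp L"
    unfolding Det_I_plus_def
  proof (rule the_equality)
    fix D
    assume D: "\<forall>\<epsilon>>0. \<exists>\<delta>>0. \<forall>F. finite_rank F \<and> trace_class (\<lambda>x. F x - S x) \<and>
      trace_norm (\<lambda>x. F x - S x) < \<delta> \<longrightarrow> dist (Det_finite_rank F) D < \<epsilon>"
    show "D = exp L"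
    proof (rule ccontr)
      assume "D \<noteq> exp L"
      then have \<epsilon>: "0 < dist D (exp L) / 2" by simp
      obtain \<delta>1 where \<delta>1: "0 < \<delta>1" "\<And>F. finite_rank F \<Longrightarrow> trace_class (\<lambda>x. F x - S x) \<Longrightarrow>
          trace_norm (\<lambda>x. F x - S x) < \<delta>1 \<Longrightarrow> dist (Det_finite_rank F) D < dist D (exp L) / 2"
        using D[rule_format, OF \<epsilon>] by blast
      obtain \<delta>2 where \<delta>2: "0 < \<delta>2" "\<And>F. finite_rank F \<Longrightarrow> trace_class (\<lambda>x. F x - S x) \<Longrightarrow>
          trace_norm (\<lambda>x. F x - S x) < \<delta>2 \<Longrightarrow> dist (Det_finite_rank F) (exp L) < dist D (exp L) / 2"
        using lim[OF \<epsilon>] by blast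
      \<comment> \<open>Within both thresholds, the determinant of this \<open>F\<close> would be
        closer than half their distance to both \<open>D\<close> and \<open>exp L\<close>.\<close>
      obtain F where F: "finite_rank F" "trace_class (\<lambda>x. F x - S x)"
        "trace_norm (\<lambda>x. F x - S x) < min \<delta>1 \<delta>2"
        using finite_rank_approximation[OF T, of "min \<delta>1 \<delta>2" z] \<delta>1(1) \<delta>2(1) unfolding S_def by auto
      then have "dist (Det_finite_rank F) D < dist D (exp L) / 2"
        "dist (Det_finite_rank F) (exp L) < dist D (exp L) / 2"
        using \<delta>1(2) \<delta>2(2) by auto
      then show False using dist_triangle_half_r[of "Det_finite_rank F" D "dist D (exp L)" "exp L"] by simp
    qed
  qed (use lim in blast)
  moreover have "S = (\<lambda>x. z *\<^sub>C T x)" by (simp add: fun_eq_iff S_def)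
  ultimately show "Det_I_plus (\<lambda>x. z *\<^sub>C T x) = exp (suminf f)" by (simp add: L_def)
qed

section \<open>Matrix symbols\<close>

text \<open>Invariance of the block makes the columns of the symbol the full coordinates of the
  images \<open>T (e l k)\<close>, so composing operators multiplies symbols.\<close>

lemma multiplier_funpow_basis:
  assumes onb: "orthonormal_basis (\<lambda>(j, k). e j k) (SIGMA j:UNIV. {..<d j})"
    and T: "bounded_clinear T" "fourier_multiplier e d T" and k: "k < d l"
  shows "(T ^^ n) (e l k) = (\<Sum>q<d l. (matrix_symbol e d T l ^\<^sub>m n) $$ (q, k) *\<^sub>C e l q)"
  using k
proof (induction n arbitrary: k)
  case 0
  then have "(\<Sum>q<d l. (matrix_symbol e d T l ^\<^sub>m 0) $$ (q, k) *\<^sub>C e l q) = (\<Sum>q<d l. if q = k then e l q else 0)"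
    by (intro sum.cong) (auto simp: matrix_symbol_def scaleC_one)
  then show ?case using 0 by simp
next
  case (Suc n)
  let ?\<sigma> = "matrix_symbol e d T l"
  have on: "orthonormal_on (e l) {..<d l}"
    using orthonormal_basis_on[OF onb] unfolding orthonormal_on_def by fastforce
  have carrier: "?\<sigma> \<in> carrier_mat (d l) (d l)" by (simp add: matrix_symbol_def)
  have "e l k \<in> component e d l"
    unfolding component_def using Suc.prems by (intro complex_vector.span_base) auto
  then have "T (e l k) \<in> cspan (e l ` {..<d l})"
    using T(2) unfolding fourier_multiplier_def component_def by blast
  then have "T (e l k) = ortho_proj (e l) {..<d l} (T (e l k))"
    using ortho_proj_span[OF on] by simp
  then have Te: "T (e l k) = (\<Sum>p<d l. ?\<sigma> $$ (p, k) *\<^sub>C e l p)"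
    using Suc.prems by (simp add: ortho_proj_def matrix_symbol_def fourier_coeff_def)
  \<comment> \<open>One \<open>T\<close> is split off inside, to match the matrix power, which gains
    its new factor on the right.\<close>
  have "(T ^^ Suc n) (e l k) = (T ^^ n) (T (e l k))" by (simp add: funpow_swap1)
  also have "\<dots> = (\<Sum>p<d l. ?\<sigma> $$ (p, k) *\<^sub>C (T ^^ n) (e l p))"
    unfolding Te bounded_clinear_sum[OF bounded_clinear_funpow[OF T(1)]]
      bounded_clinear_scale[OF bounded_clinear_funpow[OF T(1)]] ..
  also have "\<dots> = (\<Sum>p<d l. \<Sum>q<d l. ((?\<sigma> ^\<^sub>m n) $$ (q, p) * ?\<sigma> $$ (p, k)) *\<^sub>C e l q)"
    by (intro sum.cong) (auto simp: Suc.IH complex_vector.scale_sum_right scaleC_scaleC mult.commute)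
  also have "\<dots> = (\<Sum>q<d l. (\<Sum>p<d l. (?\<sigma> ^\<^sub>m n) $$ (q, p) * ?\<sigma> $$ (p, k)) *\<^sub>C e l q)"
    unfolding complex_vector.scale_sum_left by (rule sum.swap)
  also have "\<dots> = (\<Sum>q<d l. (?\<sigma> ^\<^sub>m Suc n) $$ (q, k) *\<^sub>C e l q)"
  proof (rule sum.cong[OF refl])
    fix q
    assume "q \<in> {..<d l}"
    then have "(?\<sigma> ^\<^sub>m Suc n) $$ (q, k) = (\<Sum>p<d l. (?\<sigma> ^\<^sub>m n) $$ (q, p) * ?\<sigma> $$ (p, k))"
      using Suc.prems carrier pow_carrier_mat[OF carrier, of n]
      by (simp add: scalar_prod_def atLeast0LessThan)
    then show "(\<Sum>p<d l. (?\<sigma> ^\<^sub>m n) $$ (q, p) * ?\<sigma> $$ (p, k)) *\<^sub>C e l q = (?\<sigma> ^\<^sub>m Suc n) $$ (q, k) *\<^sub>C e l q"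
      by simp
  qed
  finally show ?case .
qed

lemma mat_trace_symbol_pow:
  assumes onb: "orthonormal_basis (\<lambda>(j, k). e j k) (SIGMA j:UNIV. {..<d j})"
    and T: "bounded_clinear T" "fourier_multiplier e d T"
  shows "mat_trace (matrix_symbol e d T l ^\<^sub>m n) = (\<Sum>k<d l. cinner ((T ^^ n) (e l k)) (e l k))"
proof -
  have on: "orthonormal_on (e l) {..<d l}"
    using orthonormal_basis_on[OF onb] unfolding orthonormal_on_def by fastforce
  have "matrix_symbol e d T l \<in> carrier_mat (d l) (d l)" by (simp add: matrix_symbol_def)
  then have "dim_row (matrix_symbol e d T l ^\<^sub>m n) = d l" using pow_carrier_mat by blast
  moreover have "cinner ((T ^^ n) (e l k)) (e l k) = (matrix_symbol e d T l ^\<^sub>m n) $$ (k, k)" if "k < d l" for k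
    unfolding multiplier_funpow_basis[OF onb T that]
    using that by (intro orthonormal_on_sum_cinner[OF on]) auto
  ultimately show ?thesis unfolding mat_trace_def by simp
qed

text \<open>The diagonal sum over all pairs converges unconditionally, so it may be grouped block by
  block; each finite block sum is the trace of a power of the symbol.\<close>

lemma trace_symbol_sums:
  assumes onb: "orthonormal_basis (\<lambda>(j, k). e j k) (SIGMA j:UNIV. {..<d j})"
    and T: "trace_class T" "fourier_multiplier e d T"
  shows "(\<lambda>l. mat_trace (matrix_symbol e d T l ^\<^sub>m Suc n)) sums
    (\<Sum>\<^sub>\<infinity>i\<in>(SIGMA j:UNIV. {..<d j}). cinner ((T ^^ Suc n) ((\<lambda>(j, k). e j k) i)) ((\<lambda>(j, k). e j k) i))"
proof (rule has_sum_imp_sums, rule has_sum_SigmaD)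
  have T': "bounded_clinear T" using T(1) by (rule trace_class_singular_values)
  show "((\<lambda>i. cinner ((T ^^ Suc n) ((\<lambda>(j, k). e j k) i)) ((\<lambda>(j, k). e j k) i)) has_sum
      (\<Sum>\<^sub>\<infinity>i\<in>(SIGMA j:UNIV. {..<d j}). cinner ((T ^^ Suc n) ((\<lambda>(j, k). e j k) i)) ((\<lambda>(j, k). e j k) i)))
      (SIGMA j:UNIV. {..<d j})"
    using trace_class_powers(1)[OF T(1) onb] by (rule has_sum_infsum)
  show "((\<lambda>k. cinner ((T ^^ Suc n) ((\<lambda>(j, k). e j k) (l, k))) ((\<lambda>(j, k). e j k) (l, k))) has_sum
      mat_trace (matrix_symbol e d T l ^\<^sub>m Suc n)) {..<d l}" for l
    unfolding mat_trace_symbol_pow[OF onb T' T(2)] by (auto intro!: has_sum_finiteI)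
qed

theorem theorem3p11:
  fixes e :: "nat \<Rightarrow> nat \<Rightarrow> 'h::{complex_hilbert, second_countable_topology}"
    and d :: "nat \<Rightarrow> nat"
    and T :: "'h \<Rightarrow> 'h"
  assumes d_pos: "\<And>j. 1 \<le> d j"
    and basis: "orthonormal_basis (\<lambda>(j, k). e j k) (SIGMA j:UNIV. {..<d j})"
    and trace_class: "trace_class T"
    and multiplier: "fourier_multiplier e d T"
  shows "(\<forall>m\<ge>1. summable (\<lambda>l. mat_trace (matrix_symbol e d T l ^\<^sub>m m))) \<and>
    (\<exists>r>0. \<forall>z::complex. cmod z < r \<longrightarrow>
      summable (\<lambda>m. (-1) ^ (Suc m + 1) / of_nat (Suc m) * z ^ Suc m *
        (\<Sum>l. mat_trace (matrix_symbol e d T l ^\<^sub>m Suc m))) \<and>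
      Det_I_plus (\<lambda>x. z *\<^sub>C T x) =
        exp (\<Sum>m. (-1) ^ (Suc m + 1) / of_nat (Suc m) * z ^ Suc m *
          (\<Sum>l. mat_trace (matrix_symbol e d T l ^\<^sub>m Suc m))))"
proof (intro conjI)
  note sums = trace_symbol_sums[OF basis trace_class multiplier]
  show "\<forall>m\<ge>1. summable (\<lambda>l. mat_trace (matrix_symbol e d T l ^\<^sub>m m))"
  proof (intro allI impI)
    fix m :: nat
    assume "1 \<le> m"
    \<comment> \<open>The trace lemma is indexed by \<open>Suc n\<close>, hence the shift to
      \<open>m - 1\<close>.\<close>
    then show "summable (\<lambda>l. mat_trace (matrix_symbol e d T l ^\<^sub>m m))"
      using sums_summable[OF sums[of "m - 1"]] by simp
  qed
  define t where "t = trace_norm T"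
  have t: "0 \<le> t" unfolding t_def by (rule trace_norm_nonneg[OF trace_class])
  show "\<exists>r>0. \<forall>z::complex. cmod z < r \<longrightarrow>
      summable (\<lambda>m. (-1) ^ (Suc m + 1) / of_nat (Suc m) * z ^ Suc m *
        (\<Sum>l. mat_trace (matrix_symbol e d T l ^\<^sub>m Suc m))) \<and>
      Det_I_plus (\<lambda>x. z *\<^sub>C T x) =
        exp (\<Sum>m. (-1) ^ (Suc m + 1) / of_nat (Suc m) * z ^ Suc m *
          (\<Sum>l. mat_trace (matrix_symbol e d T l ^\<^sub>m Suc m)))"
  \<comment> \<open>The radius makes \<open>cmod z * t\<close> at most 1/4; \<open>t + 1\<close> in
    place of \<open>t\<close> keeps it positive when \<open>T = 0\<close>.\<close>
  proof (intro exI[of _ "1 / (4 * (t + 1))"] conjI allI impI)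
    show "0 < 1 / (4 * (t + 1))" using t by simp
    fix z :: complex
    assume z: "cmod z < 1 / (4 * (t + 1))"
    then have "cmod z * (t + 1) \<le> 1 / 4" using t by (simp add: field_simps)
    moreover have "cmod z * t \<le> cmod z * (t + 1)" by (intro mult_left_mono) auto
    ultimately have "cmod z * trace_norm T \<le> 1 / 4" by (simp add: t_def)
    \<comment> \<open>The unfolding replaces the diagonal sum over all pairs by the series of block
      traces.\<close>
    note det = Det_I_plus_eq_exp[OF trace_class basis this, unfolded sums_unique[OF sums]]
    show "summable (\<lambda>m. (-1) ^ (Suc m + 1) / of_nat (Suc m) * z ^ Suc m *
        (\<Sum>l. mat_trace (matrix_symbol e d T l ^\<^sub>m Suc m)))" by (rule det(1))
    show "Det_I_plus (\<lambda>x. z *\<^sub>C T x) =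
        exp (\<Sum>m. (-1) ^ (Suc m + 1) / of_nat (Suc m) * z ^ Suc m *
          (\<Sum>l. mat_trace (matrix_symbol e d T l ^\<^sub>m Suc m)))" by (rule det(2))
  qed
qed

end
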